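(* Let $\widehat\Gamma:\widehat{\mathcal K}\times\mathbb D_1\to L(Y)$ and $\Gamma:\mathcal K\times\mathbb D_1\to L(Y)$ be appropriate. Let $h\in\mathrm{Hol}(\mathbb D_1,X)$ be an $A$-spirallike mapping. Suppose that $e^{-At}\circ h\in\mathcal K$ for all $t\ge 0$ and there is $C\in L(Y)$ such that $$\Gamma\left(e^{-At}\circ h,x\right)=e^{-Ct}\,\Gamma(h,x)\quad\text{for all } t\ge 0 \text{ and } x\in\mathbb D_1 .$$ Then the mapping $\Phi[h]$, $\Phi[h](x,y)=(h(x),\Gamma(h,x)y)$ for $(x,y)\in\mathbb D$, is $\begin{pmatrix} A&0\\0&B+C\end{pmatrix}$-spirallike for any accretive operator $B\in L(Y)$ which commutes with $C$ and with $\Gamma(h,x)$ for all $x\in\mathbb D_1$ and such that the function $\mathrm{Re}\,\lambda$ is bounded away from zero on the spectrum of $B+C$.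
   Context: Setting. $X,Y$ are complex Banach spaces with norms $\|\cdot\|_X,\|\cdot\|_Y$ and open unit balls $\mathbb D_1\subset X$, $\mathbb D_2\subset Y$. $L(Y)$ denotes the bounded linear operators on $Y$ (similarly $L(X)$). $\mathrm{Hol}(D,E)$ is the set of holomorphic mappings on a domain $D$ with values in $E$; $\mathrm{Hol}(D)=\mathrm{Hol}(D,D)$. Biholomorphic mappings are understood as biholomorphic onto their images. $p:[0,1]\to[0,1]$ is a continuous, strictly decreasing function with $p(0)=1$, $p(1)=0$ and $p\left(\frac{s_1+s_2}{2}\right)\ge\frac12(p(s_1)+p(s_2))$ for all $s_1,s_2\in[0,1]$. On $Z=X\times Y$ one uses the norm (Minkowski functional) whose open unit ball is $$\mathbb D=\{(x,y)\in\mathbb D_1\times\mathbb D_2:\ \|y\|_Y<p(\|x\|_X)\}.$$ Appropriate $\widehat\Gamma$. Let $\widehat{\mathcal K}$ be a subset of $\mathrm{Hol}(\mathbb D_1)$ consisting of biholomorphic mappings and closed with respect to composition, and let $\widehat\Gamma:\widehat{\mathcal K}\times\mathbb D_1\to L(Y)$ be a mapping continuous on $\widehat{\mathcal K}$ and holomorphic on $\mathbb D_1$. $\widehat\Gamma$ is appropriate if: (i) $\mathrm{id}_X\in\widehat{\mathcal K}$ and $\widehat\Gamma(\mathrm{id}_X,x)=\mathrm{id}_Y$; (ii) $\widehat\Gamma(f,g(x))\widehat\Gamma(g,x)=\widehat\Gamma(f\circ g,x)$ for all $f,g\in\widehat{\mathcal K}$, $x\in\mathbb D_1$; (iii) $\widehat\Gamma(f,x)$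 is invertible for all $f\in\widehat{\mathcal K}$, $x\in\mathbb D_1$; (iv) $\|\widehat\Gamma(f,x)\|_{L(Y)}\le p(\|f(x)\|_X)/p(\|x\|_X)$ for all $f\in\widehat{\mathcal K}$, $x\in\mathbb D_1$. Appropriate $\Gamma$. Given $\widehat{\mathcal K}$ and an appropriate $\widehat\Gamma$, let $\mathcal K\subset\mathrm{Hol}(\mathbb D_1,X)$ be a non-empty set consisting of biholomorphic mappings and let $\Gamma:\mathcal K\times\mathbb D_1\to L(Y)$ be a mapping continuous on $\mathcal K$ and holomorphic on $\mathbb D_1$. $\Gamma$ is appropriate if: (i) for all $h_1,h_2\in\mathcal K$ with $h_1(\mathbb D_1)\subset h_2(\mathbb D_1)$, one has $h_2^{-1}\circ h_1\in\widehat{\mathcal K}$; (ii) $\Gamma(h,g(x))\widehat\Gamma(g,x)=\Gamma(h\circ g,x)$ for all $h\in\mathcal K$, $g\in\widehat{\mathcal K}$, $x\in\mathbb D_1$; (iii) $\Gamma(h,x)$ is invertible for all $h\in\mathcal K$, $x\in\mathbb D_1$. Spirallike. A biholomorphic mapping $h$ on a domain $D$ of a Banach space $E$, with values in $E$, is $A$-spirallike, where $A\in L(E)$, if the function $\mathrm{Re}\,\lambda$ is bounded away from zero on the spectrum of $A$ and $e^{-tA}w\in h(D)$ for each $w\in h(D)$ and each $t\ge 0$. This is applied with $E=X$, $D=\mathbb D_1$, and with $E=Z$, $D=\mathbb D$; the block matrix acts on $Z=X\times Y$ by $(x,y)\mapsto(Ax,(B+C)y)$. A bounded operator $B\in L(Y)$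 is accretive if $\mathrm{Re}\,\ell(By)\ge0$ for all $y\in Y$ with $\|y\|_Y=1$ and all $\ell\in Y^*$ with $\|\ell\|=\ell(y)=1$; equivalently $\|e^{-tB}\|_{L(Y)}\le 1$ for all $t\ge 0$. *)

theory Defs
  imports "HOL-Analysis.Analysis"
begin

section \<open>Complex Banach spaces\<close>

text \<open>The HOL libraries only have real Banach spaces as a type class; here a complex scalar
  multiplication is added which extends the real one and for which the norm is homogeneous.\<close>

class complex_banach = banach +
  fixes scaleC :: "complex \<Rightarrow> 'a \<Rightarrow> 'a" (infixr "*\<^sub>C" 75)
  assumes scaleC_add_right: "a *\<^sub>C (x + y) = a *\<^sub>C x + a *\<^sub>C y"
    and scaleC_add_left: "(a + b) *\<^sub>C x = a *\<^sub>C x + b *\<^sub>C x"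
    and scaleC_scaleC: "a *\<^sub>C (b *\<^sub>C x) = (a * b) *\<^sub>C x"
    and scaleC_of_real: "complex_of_real r *\<^sub>C x = r *\<^sub>R x"
    and norm_scaleC: "norm (a *\<^sub>C x) = cmod a * norm x"

lemma bounded_linear_scaleC: "bounded_linear (\<lambda>x::'a::complex_banach. c *\<^sub>C x)"
proof (rule bounded_linear_intro[where K = "cmod c"])
  fix x y :: 'a and r :: real
  show "c *\<^sub>C (x + y) = c *\<^sub>C x + c *\<^sub>C y"
    by (rule scaleC_add_right)
  show "c *\<^sub>C (r *\<^sub>R x) = r *\<^sub>R (c *\<^sub>C x)"
    by (simp add: scaleC_scaleC mult.commute flip: scaleC_of_real)
  show "norm (c *\<^sub>C x) \<le> norm x * cmod c"
    by (simp add: norm_scaleC mult.commute)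
qed

instantiation complex :: complex_banach
begin

definition scaleC_complex :: "complex \<Rightarrow> complex \<Rightarrow> complex"
  where "scaleC_complex c z = c * z"

instance
  by standard (auto simp: scaleC_complex_def algebra_simps norm_mult scaleR_conv_of_real)

end

text \<open>On \<open>X \<times> Y\<close> the type class norm is the Euclidean combination of the two norms.\<close>

instantiation prod :: (complex_banach, complex_banach) complex_banach
begin

definition scaleC_prod :: "complex \<Rightarrow> 'a \<times> 'b \<Rightarrow> 'a \<times> 'b"
  where "scaleC_prod c z = (c *\<^sub>C fst z, c *\<^sub>C snd z)"

instance
proof
  fix a :: complex and z :: "'a \<times> 'b"
  have "(cmod a * norm (fst z))\<^sup>2 + (cmod a * norm (snd z))\<^sup>2
      = (cmod a)\<^sup>2 * ((norm (fst z))\<^sup>2 + (norm (snd z))\<^sup>2)"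
    by (simp add: power_mult_distrib algebra_simps)
  then show "norm (a *\<^sub>C z) = cmod a * norm z"
    by (simp add: scaleC_prod_def norm_prod_def norm_scaleC real_sqrt_mult)
qed (auto simp: scaleC_prod_def scaleC_add_right scaleC_add_left scaleC_scaleC scaleC_of_real
       scaleR_prod_def)

end

instantiation blinfun :: (real_normed_vector, complex_banach) complex_banach
begin

definition scaleC_blinfun :: "complex \<Rightarrow> ('a \<Rightarrow>\<^sub>L 'b) \<Rightarrow> 'a \<Rightarrow>\<^sub>L 'b"
  where "scaleC_blinfun c T = Blinfun (\<lambda>v. c *\<^sub>C blinfun_apply T v)"

lemma blinfun_apply_scaleC: "blinfun_apply (c *\<^sub>C T) v = c *\<^sub>C blinfun_apply T v"
  for T :: "'a \<Rightarrow>\<^sub>L 'b"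
proof -
  have "bounded_linear (\<lambda>v. c *\<^sub>C blinfun_apply T v)"
    by (rule bounded_linear_compose[OF bounded_linear_scaleC blinfun.bounded_linear_right])
  then show ?thesis
    by (simp add: scaleC_blinfun_def bounded_linear_Blinfun_apply)
qed

instance
proof
  fix a b :: complex and r :: real and S T :: "'a \<Rightarrow>\<^sub>L 'b"
  show "a *\<^sub>C (S + T) = a *\<^sub>C S + a *\<^sub>C T"
    by (rule blinfun_eqI) (simp add: blinfun_apply_scaleC blinfun.add_left scaleC_add_right)
  show "(a + b) *\<^sub>C T = a *\<^sub>C T + b *\<^sub>C T"
    by (rule blinfun_eqI) (simp add: blinfun_apply_scaleC blinfun.add_left scaleC_add_left)
  show "a *\<^sub>C (b *\<^sub>C T) = (a * b) *\<^sub>C T"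
    by (rule blinfun_eqI) (simp add: blinfun_apply_scaleC scaleC_scaleC)
  show "complex_of_real r *\<^sub>C T = r *\<^sub>R T"
    by (rule blinfun_eqI) (simp add: blinfun_apply_scaleC blinfun.scaleR_left scaleC_of_real)
  have le: "norm (c *\<^sub>C U) \<le> cmod c * norm U" for c and U :: "'a \<Rightarrow>\<^sub>L 'b"
  proof (rule norm_blinfun_bound)
    show "norm (blinfun_apply (c *\<^sub>C U) v) \<le> cmod c * norm U * norm v" for v
      using mult_left_mono[OF norm_blinfun[of U v], of "cmod c"]
      by (simp add: blinfun_apply_scaleC norm_scaleC mult.assoc)
  qed simp
  show "norm (a *\<^sub>C T) = cmod a * norm T"
  proof (cases "a = 0")
    case True
    then show ?thesis using le[of a T] by simp
  next
    case False
    have "inverse a *\<^sub>C (a *\<^sub>C T) = T"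
    proof (rule blinfun_eqI)
      fix v
      have "inverse a *\<^sub>C (a *\<^sub>C blinfun_apply T v) = complex_of_real 1 *\<^sub>C blinfun_apply T v"
        using False by (simp add: scaleC_scaleC)
      then show "blinfun_apply (inverse a *\<^sub>C (a *\<^sub>C T)) v = blinfun_apply T v"
        by (simp only: blinfun_apply_scaleC scaleC_of_real scaleR_one)
    qed
    then have "norm T \<le> inverse (cmod a) * norm (a *\<^sub>C T)"
      using le[of "inverse a" "a *\<^sub>C T"] by (simp add: norm_inverse)
    then have "cmod a * norm T \<le> norm (a *\<^sub>C T)"
      using False by (simp add: field_simps)
    with le[of a T] show ?thesis by simp
  qed
qed

end

section \<open>Bounded complex-linear operators\<close>

definition complex_homogeneous :: "('a::complex_banach \<Rightarrow> 'b::complex_banach) \<Rightarrow> bool"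
  where "complex_homogeneous F \<longleftrightarrow> (\<forall>c v. F (c *\<^sub>C v) = c *\<^sub>C F v)"

text \<open>\<open>\<L>\<close> consists of the bounded complex-linear operators among the bounded real-linear ones.
  For \<open>'b = complex\<close> it is the complex dual space.\<close>

definition bounded_ops :: "('a::complex_banach \<Rightarrow>\<^sub>L 'b::complex_banach) set" ("\<L>")
  where "\<L> = {T. complex_homogeneous (blinfun_apply T)}"

definition invertible_op :: "('a::complex_banach \<Rightarrow>\<^sub>L 'a) \<Rightarrow> bool"
  where "invertible_op T \<longleftrightarrow> (\<exists>S\<in>\<L>. S o\<^sub>L T = id_blinfun \<and> T o\<^sub>L S = id_blinfun)"

definition op_spectrum :: "('a::complex_banach \<Rightarrow>\<^sub>L 'a) \<Rightarrow> complex set"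
  where "op_spectrum T = {z. \<not> invertible_op (T - z *\<^sub>C id_blinfun)}"

definition Re_spectrum_bounded_away :: "('a::complex_banach \<Rightarrow>\<^sub>L 'a) \<Rightarrow> bool"
  where "Re_spectrum_bounded_away T \<longleftrightarrow> (\<exists>\<delta>>0. \<forall>z\<in>op_spectrum T. \<delta> \<le> \<bar>Re z\<bar>)"

text \<open>The library function \<^const>\<open>exp\<close> needs an algebra type class, which operators do not form;
  this is the same power series with composition as product.\<close>

definition op_exp :: "('a::complex_banach \<Rightarrow>\<^sub>L 'a) \<Rightarrow> 'a \<Rightarrow>\<^sub>L 'a"
  where "op_exp T = (\<Sum>n. (((\<lambda>S. T o\<^sub>L S) ^^ n) id_blinfun) /\<^sub>R fact n)"

definition accretive :: "('a::complex_banach \<Rightarrow>\<^sub>L 'a) \<Rightarrow> bool"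
  where "accretive T \<longleftrightarrow>
    (\<forall>y. \<forall>l\<in>(\<L> :: ('a \<Rightarrow>\<^sub>L complex) set).
       norm y = 1 \<and> norm l = 1 \<and> blinfun_apply l y = 1 \<longrightarrow>
       0 \<le> Re (blinfun_apply l (blinfun_apply T y)))"

definition block_op ::
  "('a::complex_banach \<Rightarrow>\<^sub>L 'a) \<Rightarrow> ('b::complex_banach \<Rightarrow>\<^sub>L 'b) \<Rightarrow> ('a \<times> 'b) \<Rightarrow>\<^sub>L ('a \<times> 'b)"
  where "block_op S T = Blinfun (\<lambda>(x, y). (blinfun_apply S x, blinfun_apply T y))"

lemma block_op_apply [simp]:
  "blinfun_apply (block_op S T) (x, y) = (blinfun_apply S x, blinfun_apply T y)"
proof -
  have "bounded_linear (\<lambda>z. (blinfun_apply S (fst z), blinfun_apply T (snd z)))"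
    by (intro bounded_linear_Pair bounded_linear_compose[OF blinfun.bounded_linear_right]
        bounded_linear_fst bounded_linear_snd)
  then show ?thesis
    by (simp add: block_op_def case_prod_unfold bounded_linear_Blinfun_apply)
qed

section \<open>Holomorphic and spirallike mappings\<close>

text \<open>Complex Frechet differentiability; it is only used for open sets \<open>D\<close>.\<close>

definition holomorphic_map_on ::
  "('a::complex_banach \<Rightarrow> 'b::complex_banach) \<Rightarrow> 'a set \<Rightarrow> bool"
  where "holomorphic_map_on f D \<longleftrightarrow>
    (\<forall>x\<in>D. \<exists>F. (f has_derivative F) (at x) \<and> complex_homogeneous F)"

text \<open>Mappings on \<open>D\<close> are represented by extensional functions, so that equality of functions is
  equality of mappings on \<open>D\<close>; compositions are accordingly formed with \<^const>\<open>compose\<close>.\<close>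

definition Hol :: "'a::complex_banach set \<Rightarrow> 'b::complex_banach set \<Rightarrow> ('a \<Rightarrow> 'b) set"
  where "Hol D E = {f \<in> D \<rightarrow>\<^sub>E E. holomorphic_map_on f D}"

definition biholomorphic_on ::
  "('a::complex_banach \<Rightarrow> 'b::complex_banach) \<Rightarrow> 'a set \<Rightarrow> bool"
  where "biholomorphic_on f D \<longleftrightarrow>
    holomorphic_map_on f D \<and> inj_on f D \<and> open (f ` D) \<and>
    holomorphic_map_on (inv_into D f) (f ` D)"

definition spirallike_on ::
  "('a::complex_banach \<Rightarrow>\<^sub>L 'a) \<Rightarrow> ('a \<Rightarrow> 'a) \<Rightarrow> 'a set \<Rightarrow> bool"
  where "spirallike_on A h D \<longleftrightarrow>
    A \<in> \<L> \<and> biholomorphic_on h D \<and> Re_spectrum_bounded_away A \<and>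
    (\<forall>w\<in>h ` D. \<forall>t\<ge>0. blinfun_apply (op_exp (- (t *\<^sub>R A))) w \<in> h ` D)"

text \<open>Continuity with respect to uniform convergence on the balls strictly inside the unit ball.
  This topology is metrizable, hence sequences suffice.\<close>

definition continuous_on_Hol ::
  "('a::complex_banach \<Rightarrow> 'b::complex_banach) set \<Rightarrow> (('a \<Rightarrow> 'b) \<Rightarrow> 'c::topological_space) \<Rightarrow> bool"
  where "continuous_on_Hol K F \<longleftrightarrow>
    (\<forall>f\<in>K. \<forall>u. (\<forall>n. u n \<in> K) \<and> (\<forall>r<1. uniform_limit (cball 0 r) u f sequentially) \<longrightarrow>
       (\<lambda>n. F (u n)) \<longlonglongrightarrow> F f)"

section \<open>The domain in the product space and the extension operator\<close>

definition profile :: "(real \<Rightarrow> real) \<Rightarrow> bool"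
  where "profile p \<longleftrightarrow>
    p ` {0..1} \<subseteq> {0..1} \<and> continuous_on {0..1} p \<and> monotone_on {0..1} (<) (>) p \<and>
    p 0 = 1 \<and> p 1 = 0 \<and>
    (\<forall>s\<in>{0..1}. \<forall>t\<in>{0..1}. p ((s + t) / 2) \<ge> (p s + p t) / 2)"

definition ext_ball :: "(real \<Rightarrow> real) \<Rightarrow> ('a::complex_banach \<times> 'b::complex_banach) set"
  where "ext_ball p = {(x, y). x \<in> ball 0 1 \<and> y \<in> ball 0 1 \<and> norm y < p (norm x)}"

text \<open>By the following inclusions the Minkowski functional of \<^term>\<open>ext_ball p\<close> is equivalent
  to the type class norm of the product, so openness, boundedness of operators, holomorphy and
  spectra are the same for both.\<close>

lemma ext_ball_between_balls:
  assumes "profile p"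
  shows "ball 0 (1/2) \<subseteq> (ext_ball p :: ('a::complex_banach \<times> 'b::complex_banach) set)"
    and "(ext_ball p :: ('a \<times> 'b) set) \<subseteq> ball 0 2"
proof -
  have half: "p (1/2) \<ge> 1/2"
    using assms unfolding profile_def
    by (metis add_0 atLeastAtMost_iff add.right_neutral order_refl zero_le_one)
  have decr: "p t < p s" if "0 \<le> s" "s < t" "t \<le> 1" for s t
    using assms that unfolding profile_def monotone_on_def by auto
  show "ball 0 (1/2) \<subseteq> (ext_ball p :: ('a \<times> 'b) set)"
  proof
    fix z :: "'a \<times> 'b"
    assume "z \<in> ball 0 (1/2)"
    then have z: "norm (fst z) < 1/2" "norm (snd z) < 1/2"
      using norm_fst_le[of "fst z" "snd z"] norm_snd_le[of "snd z" "fst z"] by auto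
    with decr[of "norm (fst z)" "1/2"] half show "z \<in> ext_ball p"
      by (auto simp: ext_ball_def case_prod_unfold)
  qed
  show "(ext_ball p :: ('a \<times> 'b) set) \<subseteq> ball 0 2"
  proof
    fix z :: "'a \<times> 'b"
    assume "z \<in> ext_ball p"
    then have "norm (fst z) < 1" "norm (snd z) < 1"
      by (auto simp: ext_ball_def)
    with norm_Pair_le[of "fst z" "snd z"] show "z \<in> ball 0 2"
      by auto
  qed
qed

definition appropriate_hat ::
  "(real \<Rightarrow> real) \<Rightarrow> ('a::complex_banach \<Rightarrow> 'a) set \<Rightarrow>
   (('a \<Rightarrow> 'a) \<Rightarrow> 'a \<Rightarrow> ('b::complex_banach \<Rightarrow>\<^sub>L 'b)) \<Rightarrow> bool"
  where "appropriate_hat p Kh Gh \<longleftrightarrow>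
    Kh \<subseteq> Hol (ball 0 1) (ball 0 1) \<and>
    (\<forall>f\<in>Kh. biholomorphic_on f (ball 0 1)) \<and>
    (\<forall>f\<in>Kh. \<forall>g\<in>Kh. compose (ball 0 1) f g \<in> Kh) \<and>
    (\<forall>f\<in>Kh. \<forall>x\<in>ball 0 1. Gh f x \<in> \<L>) \<and>
    (\<forall>x\<in>ball 0 1. continuous_on_Hol Kh (\<lambda>f. Gh f x)) \<and>
    (\<forall>f\<in>Kh. holomorphic_map_on (Gh f) (ball 0 1)) \<and>
    restrict id (ball 0 1) \<in> Kh \<and>
    (\<forall>x\<in>ball 0 1. Gh (restrict id (ball 0 1)) x = id_blinfun) \<and>
    (\<forall>f\<in>Kh. \<forall>g\<in>Kh. \<forall>x\<in>ball 0 1. Gh f (g x) o\<^sub>L Gh g x = Gh (compose (ball 0 1) f g) x) \<and>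
    (\<forall>f\<in>Kh. \<forall>x\<in>ball 0 1. invertible_op (Gh f x)) \<and>
    (\<forall>f\<in>Kh. \<forall>x\<in>ball 0 1. norm (Gh f x) \<le> p (norm (f x)) / p (norm x))"

text \<open>\<open>G\<close> is a mapping on \<open>K \<times> ball 0 1\<close>, so the chain rule is only required where
  its right-hand side is defined, that is, when the composition belongs to \<open>K\<close>.\<close>

definition appropriate ::
  "('a::complex_banach \<Rightarrow> 'a) set \<Rightarrow> (('a \<Rightarrow> 'a) \<Rightarrow> 'a \<Rightarrow> ('b::complex_banach \<Rightarrow>\<^sub>L 'b)) \<Rightarrow>
   ('a \<Rightarrow> 'a) set \<Rightarrow> (('a \<Rightarrow> 'a) \<Rightarrow> 'a \<Rightarrow> ('b \<Rightarrow>\<^sub>L 'b)) \<Rightarrow> bool"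
  where "appropriate Kh Gh K G \<longleftrightarrow>
    K \<subseteq> Hol (ball 0 1) UNIV \<and> K \<noteq> {} \<and>
    (\<forall>h\<in>K. biholomorphic_on h (ball 0 1)) \<and>
    (\<forall>h\<in>K. \<forall>x\<in>ball 0 1. G h x \<in> \<L>) \<and>
    (\<forall>x\<in>ball 0 1. continuous_on_Hol K (\<lambda>h. G h x)) \<and>
    (\<forall>h\<in>K. holomorphic_map_on (G h) (ball 0 1)) \<and>
    (\<forall>h1\<in>K. \<forall>h2\<in>K. h1 ` ball 0 1 \<subseteq> h2 ` ball 0 1 \<longrightarrow>
       compose (ball 0 1) (inv_into (ball 0 1) h2) h1 \<in> Kh) \<and>
    (\<forall>h\<in>K. \<forall>g\<in>Kh. compose (ball 0 1) h g \<in> K \<longrightarrow>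
       (\<forall>x\<in>ball 0 1. G h (g x) o\<^sub>L Gh g x = G (compose (ball 0 1) h g) x)) \<and>
    (\<forall>h\<in>K. \<forall>x\<in>ball 0 1. invertible_op (G h x))"

definition ext_op ::
  "(real \<Rightarrow> real) \<Rightarrow> (('a::complex_banach \<Rightarrow> 'a) \<Rightarrow> 'a \<Rightarrow> ('b::complex_banach \<Rightarrow>\<^sub>L 'b)) \<Rightarrow>
   ('a \<Rightarrow> 'a) \<Rightarrow> 'a \<times> 'b \<Rightarrow> 'a \<times> 'b"
  where "ext_op p G h = (\<lambda>(x, y)\<in>ext_ball p. (h x, blinfun_apply (G h x) y))"

end

theory Submission
  imports Defs
begin

text \<open>Write \<open>h\<^sub>t = e\<^bsup>-tA\<^esup> \<circ> h\<close>. Spirallikeness of \<open>h\<close> makes \<open>g = h\<^sup>-\<^sup>1 \<circ> h\<^sub>t\<close> an element of the semigroup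
  \<open>Kh\<close>, and the chain rule for \<open>G\<close> together with the hypothesis on \<open>C\<close> gives
  \<open>e\<^bsup>-tC\<^esup> G(h, x) = G(h\<^sub>t, x) = G(h, g(x)) Gh(g, x)\<close>. Hence the flow of the block operator moves
  the image of \<open>(x, y)\<close> to the image of \<open>(g(x), e\<^bsup>-tB\<^esup> Gh(g, x) y)\<close>, which stays in the domain by the norm
  bound on \<open>Gh\<close> and because \<open>e\<^bsup>-tB\<^esup>\<close> is a contraction. Contractivity is obtained from the definition of
  accretivity by supporting functionals: they give \<open>\<parallel>y\<parallel> \<le> \<parallel>y + sBy\<parallel>\<close>, hence
  \<open>\<parallel>e\<^bsup>sB\<^esup> y\<parallel> \<ge> (1 - O(s\<^sup>2)) \<parallel>y\<parallel>\<close>. The functionals are found by Zorn's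
  lemma: a minimal sublinear function below the norm is linear.\<close>

section \<open>The operator exponential\<close>

text \<open>Sums over the squares \<open>?S1\<close> converge to the composition of the limits, and
  sums over the triangles \<open>?S2\<close> are the partial sums of the Cauchy product. Their
  difference is dominated by the same difference for the norms, which tends to 0 by the scalar
  theorem.\<close>

lemma Cauchy_product_sums_blinfun:
  fixes a :: "nat \<Rightarrow> 'b::banach \<Rightarrow>\<^sub>L 'c::banach" and b :: "nat \<Rightarrow> 'a::real_normed_vector \<Rightarrow>\<^sub>L 'b"
  assumes a: "summable (\<lambda>k. norm (a k))" and b: "summable (\<lambda>k. norm (b k))"
  shows "(\<lambda>k. \<Sum>i\<le>k. a i o\<^sub>L b (k - i)) sums ((\<Sum>k. a k) o\<^sub>L (\<Sum>k. b k))"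
proof -
  let ?S1 = "\<lambda>n::nat. {..<n} \<times> {..<n}"
  let ?S2 = "\<lambda>n::nat. {(i, j). i + j < n}"
  let ?g = "\<lambda>(i, j). a i o\<^sub>L b j"
  let ?f = "\<lambda>(i, j). norm (a i) * norm (b j)"
  have fin: "finite (?S1 n)" and sub: "?S2 n \<subseteq> ?S1 n" for n
    by auto
  have prod_blinfun: "(\<Sum>k<n. a k) o\<^sub>L (\<Sum>k<n. b k) = sum ?g (?S1 n)" for n
    unfolding bounded_bilinear.sum_left[OF bounded_bilinear_blinfun_compose]
    unfolding bounded_bilinear.sum_right[OF bounded_bilinear_blinfun_compose]
    by (rule sum.cartesian_product)
  have prod_norm: "(\<Sum>k<n. norm (a k)) * (\<Sum>k<n. norm (b k)) = sum ?f (?S1 n)" for n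
    unfolding sum_product by (rule sum.cartesian_product)
  have S1: "(\<lambda>n. sum ?g (?S1 n)) \<longlonglongrightarrow> ((\<Sum>k. a k) o\<^sub>L (\<Sum>k. b k))"
    unfolding prod_blinfun[symmetric]
    by (intro bounded_bilinear.tendsto[OF bounded_bilinear_blinfun_compose] summable_LIMSEQ
        summable_norm_cancel[OF a] summable_norm_cancel[OF b])
  have "(\<lambda>n. sum ?f (?S1 n)) \<longlonglongrightarrow> (\<Sum>k. norm (a k)) * (\<Sum>k. norm (b k))"
    unfolding prod_norm[symmetric] by (intro tendsto_mult summable_LIMSEQ a b)
  moreover have "(\<lambda>n. sum ?f (?S2 n)) \<longlonglongrightarrow> (\<Sum>k. norm (a k)) * (\<Sum>k. norm (b k))"
    using Cauchy_product_sums[of "\<lambda>k. norm (a k)" "\<lambda>k. norm (b k)"] a b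
    by (simp add: sums_def sum.triangle_reindex)
  ultimately have lim: "(\<lambda>n. sum ?f (?S1 n) - sum ?f (?S2 n)) \<longlonglongrightarrow> 0"
    using tendsto_diff by fastforce
  have bound: "norm (sum ?g (?S1 n) - sum ?g (?S2 n)) \<le> sum ?f (?S1 n) - sum ?f (?S2 n)" for n
  proof -
    have "norm (sum ?g (?S1 n - ?S2 n)) \<le> sum ?f (?S1 n - ?S2 n)"
      by (rule sum_norm_le) (auto simp: norm_blinfun_compose)
    then show ?thesis
      by (simp only: sum_diff[OF fin sub])
  qed
  have "(\<lambda>n. sum ?g (?S1 n) - sum ?g (?S2 n)) \<longlonglongrightarrow> 0"
    by (intro Lim_null_comparison[OF always_eventually lim] allI bound)
  from tendsto_diff[OF S1 this] show ?thesis
    by (simp add: sums_def sum.triangle_reindex)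
qed

text \<open>The summand of \<open>op_exp\<close>, named so that proofs can use its recursion instead
  of iterated composition.\<close>

definition exp_term :: "('a::complex_banach \<Rightarrow>\<^sub>L 'a) \<Rightarrow> nat \<Rightarrow> 'a \<Rightarrow>\<^sub>L 'a"
  where "exp_term T n = (((\<lambda>S. T o\<^sub>L S) ^^ n) id_blinfun) /\<^sub>R fact n"

section \<open>Algebra and convergence of the exponential series\<close>

lemma id_blinfun_compose [simp]: "id_blinfun o\<^sub>L T = T" "T o\<^sub>L id_blinfun = T"
  by (auto intro: blinfun_eqI)

lemmas blinfun_compose_simps =
  bounded_bilinear.add_left[OF bounded_bilinear_blinfun_compose]
  bounded_bilinear.add_right[OF bounded_bilinear_blinfun_compose]
  bounded_bilinear.diff_left[OF bounded_bilinear_blinfun_compose]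
  bounded_bilinear.diff_right[OF bounded_bilinear_blinfun_compose]
  bounded_bilinear.minus_left[OF bounded_bilinear_blinfun_compose]
  bounded_bilinear.minus_right[OF bounded_bilinear_blinfun_compose]
  bounded_bilinear.scaleR_left[OF bounded_bilinear_blinfun_compose]
  bounded_bilinear.scaleR_right[OF bounded_bilinear_blinfun_compose]

lemma blinfun_compose_assoc': "(R o\<^sub>L S) o\<^sub>L T = R o\<^sub>L (S o\<^sub>L T)"
  by (rule blinfun_eqI) simp

lemma exp_term_0 [simp]: "exp_term T 0 = id_blinfun"
  by (simp add: exp_term_def)

lemma compose_exp_term: "T o\<^sub>L exp_term T n = real (Suc n) *\<^sub>R exp_term T (Suc n)"
proof -
  have "real (Suc n) * inverse (fact (Suc n)) = inverse (fact n)"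
    by (simp add: field_simps del: of_nat_Suc)
  then show ?thesis
    by (simp add: exp_term_def blinfun_compose_simps del: of_nat_Suc fact_Suc)
qed

lemma exp_term_Suc: "exp_term T (Suc n) = (T o\<^sub>L exp_term T n) /\<^sub>R real (Suc n)"
  unfolding compose_exp_term by simp

lemma norm_exp_term_le: "norm (exp_term T n) \<le> norm T ^ n /\<^sub>R fact n"
proof (induction n)
  case 0
  then show ?case
    by (simp add: norm_blinfun_id_le)
next
  case (Suc n)
  have "norm (T o\<^sub>L exp_term T n) \<le> norm T * (norm T ^ n /\<^sub>R fact n)"
    using norm_blinfun_compose mult_left_mono[OF Suc norm_ge_zero] by (rule order_trans)
  then have "norm (exp_term T (Suc n)) \<le> norm T * (norm T ^ n /\<^sub>R fact n) / real (Suc n)"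
    by (simp add: exp_term_Suc divide_right_mono field_simps del: of_nat_Suc)
  then show ?case
    by (simp add: field_simps)
qed

lemma summable_norm_exp_term: "summable (\<lambda>n. norm (exp_term T n))"
  by (rule summable_comparison_test'[OF summable_exp_generic[of "norm T"], where N = 0])
     (use norm_exp_term_le[of T] in simp)

lemma exp_term_sums: "exp_term T sums op_exp T"
  using summable_sums[OF summable_norm_cancel[OF summable_norm_exp_term[of T]]]
  unfolding op_exp_def exp_term_def by simp

lemma exp_term_commute:
  assumes "S o\<^sub>L T = T o\<^sub>L S"
  shows "S o\<^sub>L exp_term T n = exp_term T n o\<^sub>L S"
proof (induction n)
  case (Suc n)
  have "S o\<^sub>L (T o\<^sub>L exp_term T n) = T o\<^sub>L (S o\<^sub>L exp_term T n)"
    using assms by (metis blinfun_compose_assoc')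
  also have "\<dots> = (T o\<^sub>L exp_term T n) o\<^sub>L S"
    by (simp add: Suc blinfun_compose_assoc')
  finally show ?case
    by (simp add: exp_term_Suc blinfun_compose_simps)
qed simp

text \<open>The binomial theorem with the factorials absorbed into the terms. In the induction step,
  composing with \<open>S\<close> gives the \<open>i\<close>-th summand the weight \<open>i\<close>,
  and composing with \<open>T\<close> gives it the weight \<open>Suc n - i\<close>.\<close>

lemma exp_term_add_commuting:
  assumes "S o\<^sub>L T = T o\<^sub>L S"
  shows "exp_term (S + T) n = (\<Sum>i\<le>n. exp_term S i o\<^sub>L exp_term T (n - i))"
proof (induction n)
  case 0
  then show ?case
    by simp
next
  case (Suc n)
  note sum_right = bounded_bilinear.sum_right[OF bounded_bilinear_blinfun_compose]
  have comm: "T o\<^sub>L (exp_term S i o\<^sub>L R) = exp_term S i o\<^sub>L (T o\<^sub>L R)" for i and R :: "'a \<Rightarrow>\<^sub>L 'a"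
    using exp_term_commute[of T S i] assms by (metis blinfun_compose_assoc')
  let ?c = "\<lambda>i. exp_term S i o\<^sub>L exp_term T (Suc n - i)"
  have "real (Suc n) *\<^sub>R exp_term (S + T) (Suc n)
      = (S o\<^sub>L exp_term (S + T) n) + (T o\<^sub>L exp_term (S + T) n)"
    by (simp only: compose_exp_term[symmetric] blinfun_compose_simps)
  also have "S o\<^sub>L exp_term (S + T) n = (\<Sum>i\<le>n. real (Suc i) *\<^sub>R ?c (Suc i))"
    unfolding Suc sum_right
    by (simp add: compose_exp_term blinfun_compose_simps flip: blinfun_compose_assoc'
        del: of_nat_Suc)
  \<comment> \<open>The index is shifted; the new summand at \<open>i = 0\<close> has weight
    0.\<close>
  also have "\<dots> = (\<Sum>i\<le>Suc n. real i *\<^sub>R ?c i)"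
    by (subst sum.atMost_Suc_shift) simp
  also have "T o\<^sub>L exp_term (S + T) n = (\<Sum>i\<le>n. real (Suc n - i) *\<^sub>R ?c i)"
    unfolding Suc sum_right comm
    by (intro sum.cong) (auto simp: compose_exp_term blinfun_compose_simps Suc_diff_le
        simp del: of_nat_Suc)
  \<comment> \<open>The added summand at \<open>i = Suc n\<close> has weight 0, so both sums now
    have the same range and their weights add up to \<open>Suc n\<close>.\<close>
  also have "\<dots> = (\<Sum>i\<le>Suc n. real (Suc n - i) *\<^sub>R ?c i)"
    by simp
  also have "(\<Sum>i\<le>Suc n. real i *\<^sub>R ?c i) + \<dots> = (\<Sum>i\<le>Suc n. real (Suc n) *\<^sub>R ?c i)"
    unfolding sum.distrib[symmetric]
    by (intro sum.cong) (auto simp flip: scaleR_add_left of_nat_add)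
  also have "\<dots> = real (Suc n) *\<^sub>R (\<Sum>i\<le>Suc n. ?c i)"
    by (simp only: scaleR_right.sum)
  finally show ?case
    by (simp del: sum.atMost_Suc of_nat_Suc)
qed

lemma op_exp_add_commuting:
  assumes "S o\<^sub>L T = T o\<^sub>L S"
  shows "op_exp (S + T) = op_exp S o\<^sub>L op_exp T"
proof (rule sums_unique2[OF exp_term_sums])
  show "exp_term (S + T) sums (op_exp S o\<^sub>L op_exp T)"
    using Cauchy_product_sums_blinfun[OF summable_norm_exp_term[of S] summable_norm_exp_term[of T]]
    by (simp add: exp_term_add_commuting[OF assms, abs_def] sums_unique[OF exp_term_sums, symmetric])
qed

lemma op_exp_commute:
  assumes "S o\<^sub>L T = T o\<^sub>L S"
  shows "S o\<^sub>L op_exp T = op_exp T o\<^sub>L S"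
proof (rule sums_unique2)
  note bilinear = bounded_bilinear_blinfun_compose
  show "(\<lambda>n. S o\<^sub>L exp_term T n) sums (S o\<^sub>L op_exp T)"
    by (rule bounded_linear.sums[OF bounded_bilinear.bounded_linear_right[OF bilinear] exp_term_sums])
  show "(\<lambda>n. S o\<^sub>L exp_term T n) sums (op_exp T o\<^sub>L S)"
    unfolding exp_term_commute[OF assms]
    by (rule bounded_linear.sums[OF bounded_bilinear.bounded_linear_left[OF bilinear] exp_term_sums])
qed

lemma op_exp_0 [simp]: "op_exp 0 = id_blinfun"
proof (rule sums_unique2[OF exp_term_sums])
  have "exp_term (0 :: 'a \<Rightarrow>\<^sub>L 'a) n = 0" if "n \<noteq> 0" for n
    using that by (cases n) (simp_all add: exp_term_Suc)
  then show "exp_term (0 :: 'a \<Rightarrow>\<^sub>L 'a) sums id_blinfun"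
    using sums_finite[of "{0}" "exp_term (0 :: 'a \<Rightarrow>\<^sub>L 'a)"] by simp
qed

lemma op_exp_minus_compose: "op_exp T o\<^sub>L op_exp (- T) = id_blinfun"
  using op_exp_add_commuting[of T "- T"] by (simp add: blinfun_compose_simps)

text \<open>Evaluated at a vector, the series agree term by term, and convergence in the product is
  componentwise.\<close>

lemma op_exp_block_op:
  "op_exp (block_op S T) = block_op (op_exp S) (op_exp T)"
proof (rule blinfun_eqI)
  fix z :: "'a \<times> 'b"
  have ap: "(\<lambda>n. exp_term R n v) sums op_exp R v" for R :: "'c::complex_banach \<Rightarrow>\<^sub>L 'c" and v
    by (rule bounded_linear.sums[OF bounded_linear_apply_blinfun exp_term_sums])
  obtain x y where z: "z = (x, y)"
    by force
  have "exp_term (block_op S T) n (x, y) = (exp_term S n x, exp_term T n y)" for n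
    by (induction n) (simp_all add: exp_term_Suc blinfun.scaleR_left)
  then have "(\<lambda>n. exp_term (block_op S T) n z) sums (op_exp S x, op_exp T y)"
    using tendsto_Pair[OF ap[of S x, unfolded sums_def] ap[of T y, unfolded sums_def]]
    by (simp add: z sums_def sum_prod)
  from sums_unique2[OF ap this] show "op_exp (block_op S T) z = block_op (op_exp S) (op_exp T) z"
    by (simp add: z)
qed

text \<open>The tail from degree two on is dominated by the tail of the real series, and
  \<open>exp r - 1 - r\<close> is at most the square of \<open>r\<close> for
  \<open>0 \<le> r \<le> 1\<close>.\<close>

lemma op_exp_linear_approx:
  assumes "norm T \<le> 1"
  shows "norm (op_exp T - id_blinfun - T) \<le> (norm T)\<^sup>2"
proof -
  have "(\<lambda>n. exp_term T (n + 2)) sums (op_exp T - (\<Sum>n<2. exp_term T n))"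
    by (rule sums_split_initial_segment[OF exp_term_sums])
  also have "(\<Sum>n<2. exp_term T n) = id_blinfun + T"
    by (simp add: numeral_2_eq_2 exp_term_Suc)
  finally have s: "(\<lambda>n. exp_term T (n + 2)) sums (op_exp T - id_blinfun - T)"
    by (simp add: algebra_simps)
  have "(\<lambda>n. norm T ^ (n + 2) /\<^sub>R fact (n + 2)) sums
      (exp (norm T) - (\<Sum>n<2. norm T ^ n /\<^sub>R fact n))"
    by (rule sums_split_initial_segment[OF exp_converges])
  also have "(\<Sum>n<2. norm T ^ n /\<^sub>R fact n) = 1 + norm T"
    by (simp add: numeral_2_eq_2)
  finally have "norm (op_exp T - id_blinfun - T) \<le> exp (norm T) - (1 + norm T)"
    using norm_sums_le[OF s _ norm_exp_term_le] by blast
  also have "\<dots> \<le> (norm T)\<^sup>2"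
    using exp_bound[of "norm T"] assms by simp
  finally show ?thesis .
qed

section \<open>Supporting functionals\<close>

text \<open>Homogeneity is asked only as an inequality for \<open>c > 0\<close>; using it for
  \<open>inverse c\<close> as well yields equality.\<close>

definition sublinear :: "('a::real_vector \<Rightarrow> real) \<Rightarrow> bool"
  where "sublinear q \<longleftrightarrow>
    (\<forall>x y. q (x + y) \<le> q x + q y) \<and> (\<forall>c>0. \<forall>x. q (c *\<^sub>R x) \<le> c * q x)"

lemma sublinearI:
  assumes "\<And>x y. q (x + y) \<le> q x + q y" "\<And>c x. c > 0 \<Longrightarrow> q (c *\<^sub>R x) \<le> c * q x"
  shows "sublinear q"
  using assms by (simp add: sublinear_def)

lemma sublinear_add: "sublinear q \<Longrightarrow> q (x + y) \<le> q x + q y"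
  by (simp add: sublinear_def)

lemma sublinear_scaleR:
  assumes "sublinear q" "c > 0"
  shows "q (c *\<^sub>R x) = c * q x"
proof (rule antisym)
  show "q (c *\<^sub>R x) \<le> c * q x"
    using assms by (simp add: sublinear_def)
  have "q (inverse c *\<^sub>R (c *\<^sub>R x)) \<le> inverse c * q (c *\<^sub>R x)"
    using assms unfolding sublinear_def by (metis positive_imp_inverse_positive)
  then show "c * q x \<le> q (c *\<^sub>R x)"
    using assms(2) by (simp add: field_simps)
qed

lemma sublinear_zero [simp]: "sublinear q \<Longrightarrow> q 0 = 0"
  using sublinear_scaleR[of q 2 0] by simp

lemma sublinear_scaleR_nonneg: "sublinear q \<Longrightarrow> c \<ge> 0 \<Longrightarrow> q (c *\<^sub>R x) = c * q x"
  by (cases "c = 0") (simp_all add: sublinear_scaleR)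

lemma sublinear_ge_minus: "sublinear q \<Longrightarrow> - q (- x) \<le> q x"
  using sublinear_add[of q x "- x"] by simp

text \<open>Lowers \<open>q\<close> so that the value at \<open>- y\<close> becomes at most
  \<open>- q y\<close>: the choice \<open>t = 0\<close> keeps the result below \<open>q\<close>, and
  \<open>t = 1\<close> gives the bound at \<open>- y\<close>.\<close>

definition sublinear_shift :: "('a::real_vector \<Rightarrow> real) \<Rightarrow> 'a \<Rightarrow> 'a \<Rightarrow> real"
  where "sublinear_shift q y x = (INF t\<in>{0..}. q (x + t *\<^sub>R y) - t * q y)"

lemma sublinear_shift:
  assumes "sublinear q"
  shows "sublinear (sublinear_shift q y)"
    and "t \<ge> 0 \<Longrightarrow> sublinear_shift q y x \<le> q (x + t *\<^sub>R y) - t * q y"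
proof -
  \<comment> \<open>This bound, independent of \<open>t\<close>, makes the infimum a genuine real
    infimum.\<close>
  have lower: "- q (- x) \<le> q (x + t *\<^sub>R y) - t * q y" if "t \<ge> 0" for x t
    using sublinear_add[OF assms, of "x + t *\<^sub>R y" "- x"] sublinear_scaleR_nonneg[OF assms that, of y]
    by simp
  have bdd: "bdd_below ((\<lambda>t. q (x + t *\<^sub>R y) - t * q y) ` {0..})" for x
    using lower by (intro bdd_belowI[where m = "- q (- x)"]) auto
  show upper: "sublinear_shift q y x \<le> q (x + t *\<^sub>R y) - t * q y" if "t \<ge> 0" for x t
    unfolding sublinear_shift_def using that by (intro cINF_lower[OF bdd]) auto
  have greatest: "b \<le> sublinear_shift q y x"
    if "\<And>t. t \<ge> 0 \<Longrightarrow> b \<le> q (x + t *\<^sub>R y) - t * q y" for b x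
    unfolding sublinear_shift_def using that by (intro cINF_greatest) auto
  show "sublinear (sublinear_shift q y)"
  proof (rule sublinearI)
    fix u v
    \<comment> \<open>Parameters \<open>s\<close> for \<open>u\<close> and \<open>t\<close> for
      \<open>v\<close> combine to \<open>s + t\<close> for \<open>u + v\<close>; the infimum is
      taken first over \<open>s\<close>, then over \<open>t\<close>.\<close>
    have "sublinear_shift q y (u + v) - (q (v + t *\<^sub>R y) - t * q y) \<le> sublinear_shift q y u"
      if "t \<ge> 0" for t
    proof (rule greatest)
      fix s :: real
      assume "s \<ge> 0"
      with that have "sublinear_shift q y (u + v) \<le> q (u + v + (s + t) *\<^sub>R y) - (s + t) * q y"
        by (intro upper) auto
      also have "u + v + (s + t) *\<^sub>R y = (u + s *\<^sub>R y) + (v + t *\<^sub>R y)"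
        by (simp add: algebra_simps)
      finally show "sublinear_shift q y (u + v) - (q (v + t *\<^sub>R y) - t * q y)
          \<le> q (u + s *\<^sub>R y) - s * q y"
        using sublinear_add[OF assms, of "u + s *\<^sub>R y" "v + t *\<^sub>R y"] by (simp add: algebra_simps)
    qed
    then have "sublinear_shift q y (u + v) - sublinear_shift q y u \<le> sublinear_shift q y v"
      by (intro greatest) (simp add: algebra_simps)
    then show "sublinear_shift q y (u + v) \<le> sublinear_shift q y u + sublinear_shift q y v"
      by simp
  next
    fix c :: real and u
    assume c: "c > 0"
    have "sublinear_shift q y (c *\<^sub>R u) / c \<le> sublinear_shift q y u"
    proof (rule greatest)
      fix t :: real
      assume "t \<ge> 0"
      \<comment> \<open>Homogeneity matches the parameter \<open>t\<close> for \<open>u\<close> with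
        \<open>c * t\<close> for \<open>c *\<^sub>R u\<close>.\<close>
      with c have "sublinear_shift q y (c *\<^sub>R u) \<le> q (c *\<^sub>R (u + t *\<^sub>R y)) - c * t * q y"
        using upper[of "c * t" "c *\<^sub>R u"] by (simp add: scaleR_add_right)
      with c show "sublinear_shift q y (c *\<^sub>R u) / c \<le> q (u + t *\<^sub>R y) - t * q y"
        unfolding sublinear_scaleR[OF assms c] by (simp add: field_simps)
    qed
    with c show "sublinear_shift q y (c *\<^sub>R u) \<le> c * sublinear_shift q y u"
      by (simp add: field_simps)
  qed
qed

text \<open>Zorn's lemma: the pointwise infimum of a nonempty chain is again sublinear, and it is
  finite because every member is bounded below at \<open>x\<close> by
  \<open>- q (- x)\<close>.\<close>

lemma ex_minimal_sublinear:
  assumes "sublinear q"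
  shows "\<exists>m. sublinear m \<and> m \<le> q \<and> (\<forall>r. sublinear r \<longrightarrow> r \<le> m \<longrightarrow> r = m)"
proof -
  let ?S = "{r. sublinear r \<and> r \<le> q}"
  have "\<exists>m\<in>?S. \<forall>r\<in>?S. r \<le> m \<longrightarrow> r = m"
  proof (rule predicate_Zorn)
    \<comment> \<open>The order is reversed, so that the maximal element supplied by Zorn's lemma is
      a minimal function.\<close>
    show "partial_order_on ?S (relation_of (\<lambda>r s. s \<le> r) ?S)"
      by (rule partial_order_on_relation_ofI) auto
  next
    fix F
    assume "F \<in> Chains (relation_of (\<lambda>r s. s \<le> r) ?S)"
    then have F: "\<And>r. r \<in> F \<Longrightarrow> sublinear r" "\<And>r. r \<in> F \<Longrightarrow> r \<le> q"
      and chain: "\<And>r s. r \<in> F \<Longrightarrow> s \<in> F \<Longrightarrow> r \<le> s \<or> s \<le> r"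
      by (auto simp: Chains_def relation_of_def)
    show "\<exists>u\<in>?S. \<forall>r\<in>F. u \<le> r"
    proof (cases "F = {}")
      case True
      with assms show ?thesis by auto
    next
      case False
      define u where "u = (\<lambda>x. INF r\<in>F. r x)"
      have bdd: "bdd_below ((\<lambda>r. r x) ` F)" for x
      proof (rule bdd_belowI2)
        fix r
        assume r: "r \<in> F"
        show "- q (- x) \<le> r x"
          using sublinear_ge_minus[OF F(1)[OF r], of x] le_funD[OF F(2)[OF r], of "- x"] by simp
      qed
      have upper: "u x \<le> r x" if "r \<in> F" for r x
        unfolding u_def using that by (intro cINF_lower[OF bdd])
      have greatest: "b \<le> u x" if "\<And>r. r \<in> F \<Longrightarrow> b \<le> r x" for b x
        unfolding u_def using that False by (intro cINF_greatest)
      have "sublinear u"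
      proof (rule sublinearI)
        fix x y
        \<comment> \<open>The two infima on the right are taken over different members; the smaller
          of \<open>r\<close> and \<open>s\<close> in the chain serves both.\<close>
        have "u (x + y) \<le> r x + s y" if rs: "r \<in> F" "s \<in> F" for r s
        proof -
          obtain v where "v \<in> F" "v \<le> r" "v \<le> s"
            using chain[OF rs] rs by blast
          with upper[of v "x + y"] sublinear_add[OF F(1)[of v], of x y] show ?thesis
            by (fastforce dest: le_funD[where x = x] le_funD[where x = y])
        qed
        then have "u (x + y) - s y \<le> u x" if "s \<in> F" for s
          using that by (intro greatest) (simp add: algebra_simps)
        then have "u (x + y) - u x \<le> u y"
          by (intro greatest) (simp add: algebra_simps)
        then show "u (x + y) \<le> u x + u y"
          by simp
      next
        fix c :: real and x
        assume c: "c > 0"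
        have "u (c *\<^sub>R x) / c \<le> u x"
        proof (rule greatest)
          fix r
          assume "r \<in> F"
          with upper[of r "c *\<^sub>R x"] sublinear_scaleR[OF F(1) c, of r x] c
          show "u (c *\<^sub>R x) / c \<le> r x"
            by (simp add: field_simps)
        qed
        with c show "u (c *\<^sub>R x) \<le> c * u x"
          by (simp add: field_simps)
      qed
      moreover obtain r where "r \<in> F"
        using False by blast
      with upper F(2) have "u \<le> q"
        by (meson le_funI le_funD order_trans)
      ultimately show ?thesis
        using upper by (auto intro!: bexI[of _ u] le_funI)
    qed
  qed
  then show ?thesis
    by (metis (mono_tags, lifting) mem_Collect_eq order_trans)
qed

text \<open>The shift of \<open>m\<close> in any direction \<open>y\<close> lies below
  \<open>m\<close>, hence equals it. Its bound at \<open>t = 1\<close> is then the missing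
  inequality of additivity.\<close>

lemma minimal_sublinear_linear:
  assumes "sublinear m" and minimal: "\<And>r. sublinear r \<Longrightarrow> r \<le> m \<Longrightarrow> r = m"
  shows "linear m"
proof -
  have add: "m (x + y) = m x + m y" for x y
  proof (rule antisym)
    show "m (x + y) \<le> m x + m y"
      by (rule sublinear_add[OF assms(1)])
    have "sublinear_shift m y \<le> m"
      using sublinear_shift(2)[OF assms(1), of 0 y] by (auto intro!: le_funI)
    then have "sublinear_shift m y = m"
      by (intro minimal sublinear_shift(1) assms(1))
    with sublinear_shift(2)[OF assms(1), of 1 y x] show "m x + m y \<le> m (x + y)"
      by simp
  qed
  have minus: "m (- x) = - m x" for x
    using add[of x "- x"] sublinear_zero[OF assms(1)] by simp
  show ?thesis
  proof (rule linearI)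
    fix c x
    show "m (c *\<^sub>R x) = c *\<^sub>R m x"
    proof (cases "c \<ge> 0")
      case True
      then show ?thesis
        by (simp add: sublinear_scaleR_nonneg[OF assms(1)])
    next
      case False
      then have "m (c *\<^sub>R x) = - m ((- c) *\<^sub>R x)"
        using minus[of "(- c) *\<^sub>R x"] by simp
      with False show ?thesis
        by (simp add: sublinear_scaleR_nonneg[OF assms(1)] del: scaleR_minus_left)
    qed
  qed (rule add)
qed

text \<open>A minimal function is taken below the shifted norm instead of the norm. Its value at
  \<open>- y\<close> is then at most \<open>- norm y\<close>, and linearity turns this into
  attainment of the norm at \<open>y\<close>.\<close>

lemma ex_real_support_functional:
  fixes y :: "'a::real_normed_vector"
  shows "\<exists>u. linear u \<and> (\<forall>x. u x \<le> norm x) \<and> u y = norm y"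
proof -
  have norm: "sublinear (norm :: 'a \<Rightarrow> real)"
    by (rule sublinearI) (auto simp: norm_triangle_ineq)
  obtain u where u: "sublinear u" "u \<le> sublinear_shift norm y"
    and minimal: "\<And>r. sublinear r \<Longrightarrow> r \<le> u \<Longrightarrow> r = u"
    using ex_minimal_sublinear[OF sublinear_shift(1)[OF norm]] by metis
  have linear: "linear u"
    by (rule minimal_sublinear_linear[OF u(1) minimal])
  have le: "u x \<le> norm x" for x
    using le_funD[OF u(2), of x] sublinear_shift(2)[OF norm, of 0 y x] by simp
  have "u (- y) \<le> - norm y"
    using le_funD[OF u(2), of "- y"] sublinear_shift(2)[OF norm, of 1 y "- y"] by simp
  with linear_neg[OF linear, of y] have "norm y \<le> u y"
    by simp
  with le[of y] have "u y = norm y"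
    by simp
  with linear le show ?thesis
    by blast
qed

text \<open>The real functional \<open>u\<close> is the real part of a unique complex-linear one,
  \<open>u v - \<i> * u (\<i> v)\<close>; the bound by the norm carries over by rotation of
  \<open>v\<close>.\<close>

lemma ex_support_functional:
  fixes y :: "'a::complex_banach"
  assumes y: "norm y = 1"
  shows "\<exists>l\<in>(\<L> :: ('a \<Rightarrow>\<^sub>L complex) set). norm l = 1 \<and> blinfun_apply l y = 1"
proof -
  obtain u where u: "linear u" "\<And>x. u x \<le> norm x" "u y = norm y"
    using ex_real_support_functional by metis
  define l where "l v = Complex (u v) (- u (\<i> *\<^sub>C v))" for v :: 'a
  have hom: "l (c *\<^sub>C v) = c * l v" for c v
  proof -
    have exp: "c *\<^sub>C v = Re c *\<^sub>R v + Im c *\<^sub>R (\<i> *\<^sub>C v)" for c and v :: 'a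
      unfolding scaleC_of_real[symmetric] scaleC_scaleC scaleC_add_left[symmetric]
      by (simp add: complex_eq[symmetric] mult.commute)
    have "\<i> *\<^sub>C (c *\<^sub>C v) = (- Im c) *\<^sub>R v + Re c *\<^sub>R (\<i> *\<^sub>C v)"
      unfolding scaleC_scaleC by (subst exp) simp
    with exp[of c v] show ?thesis
      by (simp only: l_def linear_add[OF u(1)] linear_scale[OF u(1)]) (simp add: complex_eq_iff)
  qed
  have bound: "cmod (l v) \<le> norm v" for v
  proof (cases "l v = 0")
    case False
    \<comment> \<open>This factor has modulus 1 and turns \<open>l v\<close> into its modulus, a
      real number, to which the bound on \<open>u\<close> applies.\<close>
    define c where "c = cnj (l v) / cmod (l v)"
    have "l (c *\<^sub>C v) = cmod (l v)"
      using False by (simp add: hom c_def complex_norm_square[symmetric] power2_eq_square mult.commute)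
    then have "cmod (l v) = u (c *\<^sub>C v)"
      by (simp add: l_def complex_eq_iff)
    also have "\<dots> \<le> norm v"
      using u(2)[of "c *\<^sub>C v"] False by (simp add: norm_scaleC c_def norm_divide)
    finally show ?thesis .
  qed simp
  have "bounded_linear l"
  proof (rule bounded_linear_intro[where K = 1])
    show "l (v + w) = l v + l w" for v w
      by (simp add: l_def scaleC_add_right linear_add[OF u(1)] complex_eq_iff)
    show "l (r *\<^sub>R v) = r *\<^sub>R l v" for r v
      using hom[of "complex_of_real r" v] by (simp add: scaleC_of_real scaleR_conv_of_real)
  qed (simp add: bound)
  note app = bounded_linear_Blinfun_apply[OF this]
  have "l y = 1"
  proof -
    \<comment> \<open>Real part 1 and modulus at most 1 leave no room for an imaginary part.\<close>
    have Re: "Re (l y) = 1"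
      using u(3) y by (simp add: l_def)
    moreover have "(Re (l y))\<^sup>2 + (Im (l y))\<^sup>2 \<le> 1"
      using bound[of y] y by (simp add: cmod_def)
    ultimately show ?thesis
      by (simp add: complex_eq_iff)
  qed
  moreover have "norm (Blinfun l) = 1"
  proof (rule antisym)
    show "norm (Blinfun l) \<le> 1"
      by (rule norm_blinfun_bound) (simp_all add: app bound)
    show "1 \<le> norm (Blinfun l)"
      using norm_blinfun[of "Blinfun l" y] by (simp add: app y \<open>l y = 1\<close>)
  qed
  ultimately show ?thesis
    by (intro bexI[of _ "Blinfun l"])
       (simp_all add: app bounded_ops_def complex_homogeneous_def hom scaleC_complex_def)
qed

section \<open>Accretive operators\<close>

text \<open>On the unit sphere, a functional \<open>l\<close> supporting at \<open>y\<close> takes a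
  value of real part at least 1 at the perturbed vector, and \<open>l\<close> has norm 1. Other
  vectors follow by scaling.\<close>

lemma accretive_norm_le:
  assumes "accretive B" "s \<ge> 0"
  shows "norm y \<le> norm (y + s *\<^sub>R blinfun_apply B y)"
proof -
  have unit: "1 \<le> norm (y + s *\<^sub>R blinfun_apply B y)" if y: "norm y = 1" for y
  proof -
    obtain l where l: "l \<in> (\<L> :: ('a \<Rightarrow>\<^sub>L complex) set)" "norm l = 1" "blinfun_apply l y = 1"
      using ex_support_functional[OF y] by blast
    then have "0 \<le> Re (l (B y))"
      using assms(1) y unfolding accretive_def by blast
    then have "1 \<le> Re (l (y + s *\<^sub>R B y))"
      using assms(2) l(3) by (simp add: blinfun.add_right blinfun.scaleR_right)
    also have "\<dots> \<le> norm (y + s *\<^sub>R B y)"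
      using complex_Re_le_cmod norm_blinfun[of l "y + s *\<^sub>R B y"] l(2)
      by (metis mult_1 order_trans)
    finally show ?thesis .
  qed
  show ?thesis
  proof (cases "y = 0")
    case False
    let ?v = "y /\<^sub>R norm y"
    have "?v + s *\<^sub>R B ?v = (y + s *\<^sub>R B y) /\<^sub>R norm y"
      by (simp add: blinfun.scaleR_right scaleR_add_right mult.commute)
    with unit[of ?v] False have "1 \<le> norm (y + s *\<^sub>R B y) / norm y"
      by (simp add: divide_inverse mult.commute)
    with False show ?thesis
      by (simp add: field_simps)
  qed simp
qed

lemma op_exp_add_scaleR: "op_exp ((s + t) *\<^sub>R T) = op_exp (s *\<^sub>R T) o\<^sub>L op_exp (t *\<^sub>R T)"
  by (simp add: scaleR_add_left op_exp_add_commuting blinfun_compose_simps mult.commute)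

text \<open>The first-order part, identity plus \<open>s *\<^sub>R B\<close>, does not shrink
  vectors; the remainder of the exponential is quadratic in \<open>s\<close>.\<close>

lemma norm_op_exp_accretive_ge:
  assumes B: "accretive B" and s: "s \<ge> 0" "s * norm B \<le> 1"
  shows "(1 - (s * norm B)\<^sup>2) * norm y \<le> norm (op_exp (s *\<^sub>R B) y)"
proof -
  let ?R = "op_exp (s *\<^sub>R B) - id_blinfun - s *\<^sub>R B"
  have "norm (?R y) \<le> (s * norm B)\<^sup>2 * norm y"
    using norm_blinfun[of ?R y] op_exp_linear_approx[of "s *\<^sub>R B"] s
    by (smt (verit) abs_of_nonneg mult_right_mono norm_ge_zero norm_scaleR)
  moreover have "op_exp (s *\<^sub>R B) y = (y + s *\<^sub>R B y) + ?R y"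
    by (simp add: blinfun.bilinear_simps)
  moreover have "norm y \<le> norm (y + s *\<^sub>R B y)"
    by (rule accretive_norm_le[OF B s(1)])
  ultimately show ?thesis
    using norm_diff_ineq[of "y + s *\<^sub>R B y" "?R y"] by (simp add: algebra_simps)
qed

text \<open>Each of the \<open>n\<close> steps of length \<open>t / n\<close> loses only a factor \<open>1 - O(1 / n\<^sup>2)\<close>, so the total
  loss vanishes as \<open>n\<close> tends to infinity.\<close>

lemma norm_op_exp_accretive_expansive:
  assumes B: "accretive B" and t: "t \<ge> 0"
  shows "norm y \<le> norm (op_exp (t *\<^sub>R B) y)"
proof -
  define c where "c = t * norm B"
  have "c \<ge> 0"
    using t by (simp add: c_def)
  \<comment> \<open>The condition \<open>c \<le> real n\<close> makes the steps short enough for the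
    quadratic estimate and keeps the loss \<open>\<delta>\<close> per step at most 1.\<close>
  have est: "(1 - c\<^sup>2 / real n) * norm y \<le> norm (op_exp (t *\<^sub>R B) y)" if n: "n > 0" "c \<le> real n" for n
  proof -
    define s where "s = t / real n"
    define \<delta> where "\<delta> = (c / real n)\<^sup>2"
    have s: "s \<ge> 0" "s * norm B = c / real n" "s * norm B \<le> 1"
      using t n by (simp_all add: s_def c_def field_simps)
    have \<delta>: "0 \<le> \<delta>" "\<delta> \<le> 1"
      using \<open>c \<ge> 0\<close> n by (simp_all add: \<delta>_def power_le_one)
    have step: "(1 - \<delta>) * norm z \<le> norm (op_exp (s *\<^sub>R B) z)" for z
      using norm_op_exp_accretive_ge[OF B s(1,3), of z] by (simp add: s(2) \<delta>_def)
    have iter: "(1 - \<delta>) ^ k * norm y \<le> norm (op_exp ((real k * s) *\<^sub>R B) y)" for k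
    proof (induction k)
      case (Suc k)
      have "(1 - \<delta>) ^ Suc k * norm y \<le> (1 - \<delta>) * norm (op_exp ((real k * s) *\<^sub>R B) y)"
        using mult_left_mono[OF Suc, of "1 - \<delta>"] \<delta>(2) by (simp add: mult.assoc)
      also have "\<dots> \<le> norm (op_exp (s *\<^sub>R B) (op_exp ((real k * s) *\<^sub>R B) y))"
        by (rule step)
      also have "op_exp (s *\<^sub>R B) (op_exp ((real k * s) *\<^sub>R B) y) = op_exp ((real (Suc k) * s) *\<^sub>R B) y"
        by (simp add: distrib_right op_exp_add_scaleR)
      finally show ?case .
    qed simp
    have "1 - c\<^sup>2 / real n = 1 - real n * \<delta>"
      using n by (simp add: \<delta>_def power2_eq_square)
    \<comment> \<open>Bernoulli's inequality bounds the accumulated loss by \<open>n\<close> times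
      the loss of one step.\<close>
    also have "\<dots> \<le> (1 - \<delta>) ^ n"
      using Bernoulli_inequality[of "- \<delta>" n] \<delta>(2) by simp
    finally have "(1 - c\<^sup>2 / real n) * norm y \<le> (1 - \<delta>) ^ n * norm y"
      by (rule mult_right_mono) simp
    also have "\<dots> \<le> norm (op_exp (t *\<^sub>R B) y)"
      using iter[of n] n by (simp add: s_def)
    finally show ?thesis .
  qed
  have "(\<lambda>n. (1 - c\<^sup>2 / real n) * norm y) \<longlonglongrightarrow> (1 - 0) * norm y"
    by (intro tendsto_intros lim_const_over_n)
  moreover have "\<forall>\<^sub>F n in sequentially. (1 - c\<^sup>2 / real n) * norm y \<le> norm (op_exp (t *\<^sub>R B) y)"
    using eventually_gt_at_top[of 0] eventually_ge_at_top[of "nat \<lceil>c\<rceil>"]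
    by eventually_elim (rule est, auto simp: nat_ceiling_le_eq)
  ultimately show ?thesis
    using tendsto_upperbound by fastforce
qed

text \<open>Expansiveness of the forward exponential, applied to the vector that it maps to
  \<open>y\<close>.\<close>

lemma op_exp_accretive_contraction:
  assumes "accretive B" "t \<ge> 0"
  shows "norm (op_exp (- (t *\<^sub>R B)) y) \<le> norm y"
proof -
  have "op_exp (t *\<^sub>R B) (op_exp (- (t *\<^sub>R B)) y) = y"
    using op_exp_minus_compose[of "t *\<^sub>R B"]
    by (metis blinfun_apply_blinfun_compose blinfun_apply_id_blinfun)
  with norm_op_exp_accretive_expansive[OF assms, of "op_exp (- (t *\<^sub>R B)) y"] show ?thesis
    by simp
qed

section \<open>Holomorphic mappings\<close>

lemma scaleC_minus_right: "c *\<^sub>C (- x) = - (c *\<^sub>C x)"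
  using linear_neg[OF bounded_linear.linear[OF bounded_linear_scaleC]] .

lemma holomorphic_map_on_subset: "holomorphic_map_on f D \<Longrightarrow> E \<subseteq> D \<Longrightarrow> holomorphic_map_on f E"
  by (auto simp: holomorphic_map_on_def)

lemma holomorphic_map_on_cong:
  assumes "open D" "\<And>x. x \<in> D \<Longrightarrow> f x = g x" "holomorphic_map_on g D"
  shows "holomorphic_map_on f D"
  unfolding holomorphic_map_on_def
proof
  fix x
  assume x: "x \<in> D"
  with assms(3) obtain F where "(g has_derivative F) (at x)" "complex_homogeneous F"
    by (auto simp: holomorphic_map_on_def)
  with has_derivative_transform_within_open[OF _ assms(1) x, of g F UNIV f] assms(2)
  show "\<exists>F. (f has_derivative F) (at x) \<and> complex_homogeneous F"
    by (metis)
qed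

lemma holomorphic_map_on_imp_continuous_on: "holomorphic_map_on f D \<Longrightarrow> continuous_on D f"
  unfolding holomorphic_map_on_def
  by (meson continuous_at_imp_continuous_on has_derivative_continuous)

lemma holomorphic_map_on_compose:
  assumes "holomorphic_map_on f D" "holomorphic_map_on g E" "f ` D \<subseteq> E"
  shows "holomorphic_map_on (\<lambda>x. g (f x)) D"
  unfolding holomorphic_map_on_def
proof
  fix x
  assume x: "x \<in> D"
  obtain F where F: "(f has_derivative F) (at x)" "complex_homogeneous F"
    using assms(1) x by (auto simp: holomorphic_map_on_def)
  obtain F' where F': "(g has_derivative F') (at (f x))" "complex_homogeneous F'"
    using assms(2,3) x by (auto simp: holomorphic_map_on_def)
  show "\<exists>F. ((\<lambda>x. g (f x)) has_derivative F) (at x) \<and> complex_homogeneous F"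
    using has_derivative_compose[OF F(1) F'(1)] F(2) F'(2)
    by (auto simp: complex_homogeneous_def)
qed

text \<open>The product rule for operator evaluation gives the real derivative. Complex linearity of
  each \<open>T x\<close> makes its part in the second variable complex homogeneous.\<close>

lemma holomorphic_map_on_skew_product:
  fixes f :: "'a::complex_banach \<Rightarrow> 'b::complex_banach"
    and T :: "'a \<Rightarrow> 'c::complex_banach \<Rightarrow>\<^sub>L 'd::complex_banach"
  assumes f: "holomorphic_map_on f D" and T: "holomorphic_map_on T D"
    and lin: "\<And>x. x \<in> D \<Longrightarrow> T x \<in> \<L>"
  shows "holomorphic_map_on (\<lambda>z. (f (fst z), T (fst z) (snd z))) (D \<times> UNIV)"
  unfolding holomorphic_map_on_def
proof
  fix z :: "'a \<times> 'c"
  assume "z \<in> D \<times> UNIV"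
  then have x: "fst z \<in> D"
    by auto
  obtain F where F: "(f has_derivative F) (at (fst z))" "complex_homogeneous F"
    using f x by (auto simp: holomorphic_map_on_def)
  obtain T' where T': "(T has_derivative T') (at (fst z))" "complex_homogeneous T'"
    using T x by (auto simp: holomorphic_map_on_def)
  let ?D = "\<lambda>v. (F (fst v), T (fst z) (snd v) + T' (fst v) (snd z))"
  have fst: "(fst has_derivative fst) (at z)" and snd: "(snd has_derivative snd) (at z)"
    by (auto intro!: derivative_eq_intros)
  have "((\<lambda>z. (f (fst z), T (fst z) (snd z))) has_derivative ?D) (at z)"
    by (intro has_derivative_Pair has_derivative_compose[OF fst F(1)] snd
        bounded_bilinear.FDERIV[OF bounded_bilinear_blinfun_apply]
        has_derivative_compose[OF fst T'(1)])
  moreover have "complex_homogeneous ?D"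
    using F(2) T'(2) lin[OF x]
    by (simp add: complex_homogeneous_def bounded_ops_def scaleC_prod_def blinfun_apply_scaleC
        scaleC_add_right)
  ultimately show "\<exists>F. ((\<lambda>z. (f (fst z), T (fst z) (snd z))) has_derivative F) (at z) \<and> complex_homogeneous F"
    by blast
qed

text \<open>Everything comes from the identity \<open>resolvent\<close>: it yields first local
  boundedness of \<open>S\<close>, then continuity, and finally the derivative
  \<open>- (S x o\<^sub>L T' v o\<^sub>L S x)\<close>.\<close>

lemma holomorphic_map_on_inverse:
  fixes T S :: "'a::complex_banach \<Rightarrow> 'b::complex_banach \<Rightarrow>\<^sub>L 'b"
  assumes T: "holomorphic_map_on T D" and D: "open D"
    and S: "\<And>x. x \<in> D \<Longrightarrow> S x \<in> \<L>"
    and inv: "\<And>x. x \<in> D \<Longrightarrow> S x o\<^sub>L T x = id_blinfun" "\<And>x. x \<in> D \<Longrightarrow> T x o\<^sub>L S x = id_blinfun"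
  shows "holomorphic_map_on S D"
  unfolding holomorphic_map_on_def
proof
  fix x
  assume x: "x \<in> D"
  obtain T' where T': "(T has_derivative T') (at x)" "complex_homogeneous T'"
    using T x by (auto simp: holomorphic_map_on_def)
  interpret T': bounded_linear T'
    by (rule has_derivative_bounded_linear[OF T'(1)])
  note compose_tendsto = bounded_bilinear.tendsto[OF bounded_bilinear_blinfun_compose]
  have in_D: "\<forall>\<^sub>F z in at x. z \<in> D"
    using D x by (rule eventually_at_in_open')
  have resolvent: "S z - S x = S z o\<^sub>L (T x - T z) o\<^sub>L S x" if "z \<in> D" for z
    using inv[OF that] inv[OF x]
    by (simp add: blinfun_compose_simps blinfun_compose_assoc')
  have norm3: "norm (P o\<^sub>L Q o\<^sub>L R) \<le> norm P * norm Q * norm R"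
    for P Q R :: "'b \<Rightarrow>\<^sub>L 'b"
    by (meson mult_right_mono norm_blinfun_compose norm_ge_zero order_trans)
  have T_lim: "((\<lambda>z. T z) \<longlongrightarrow> T x) (at x)"
    using has_derivative_continuous[OF T'(1)] by (simp add: continuous_at)
  have "((\<lambda>z. norm (T x - T z) * norm (S x)) \<longlongrightarrow> norm (T x - T x) * norm (S x)) (at x)"
    by (intro tendsto_intros T_lim)
  \<comment> \<open>With this factor below 1/2, the term containing \<open>norm (S z)\<close> on the
    right can be absorbed into the left-hand side.\<close>
  then have "\<forall>\<^sub>F z in at x. norm (T x - T z) * norm (S x) < 1/2"
    by (intro order_tendstoD) auto
  then have bound: "\<forall>\<^sub>F z in at x. norm (S z) \<le> 2 * norm (S x)"
    using in_D
  proof eventually_elim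
    case (elim z)
    have "norm (S z) \<le> norm (S x) + norm (S z - S x)"
      by (rule norm_triangle_sub)
    also have "norm (S z - S x) \<le> norm (S z) * (norm (T x - T z) * norm (S x))"
      using norm3 resolvent[OF elim(2)] by (simp add: mult.assoc)
    also have "\<dots> \<le> norm (S z) * (1/2)"
      using elim(1) by (intro mult_left_mono) auto
    finally show ?case
      by simp
  qed
  have S_lim: "((\<lambda>z. S z - S x) \<longlongrightarrow> 0) (at x)"
  proof (rule Lim_null_comparison)
    show "\<forall>\<^sub>F z in at x. norm (S z - S x) \<le> 2 * norm (S x) * norm (T x - T z) * norm (S x)"
      using bound in_D
    proof eventually_elim
      case (elim z)
      have "norm (S z - S x) \<le> norm (S z) * norm (T x - T z) * norm (S x)"
        using norm3 resolvent[OF elim(2)] by simp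
      also have "\<dots> \<le> 2 * norm (S x) * norm (T x - T z) * norm (S x)"
        using elim(1) by (intro mult_right_mono) auto
      finally show ?case .
    qed
    have "((\<lambda>z. 2 * norm (S x) * norm (T x - T z) * norm (S x))
        \<longlongrightarrow> 2 * norm (S x) * norm (T x - T x) * norm (S x)) (at x)"
      by (intro tendsto_intros T_lim)
    then show "((\<lambda>z. 2 * norm (S x) * norm (T x - T z) * norm (S x)) \<longlongrightarrow> 0) (at x)"
      by simp
  qed
  let ?D = "\<lambda>v. - (S x o\<^sub>L T' v o\<^sub>L S x)"
  let ?r = "\<lambda>z. (T z - T x - T' (z - x)) /\<^sub>R norm (z - x)"
  have "bounded_linear ?D"
    by (intro bounded_linear_minus bounded_linear_compose[OF _ T'.bounded_linear]
        bounded_bilinear.bounded_linear_left[OF bounded_bilinear_blinfun_compose, THEN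
          bounded_linear_compose]
        bounded_bilinear.bounded_linear_right[OF bounded_bilinear_blinfun_compose])
  moreover have "((\<lambda>z. (S z - S x - ?D (z - x)) /\<^sub>R norm (z - x)) \<longlongrightarrow> 0) (at x)"
  proof (rule Lim_null_comparison)
    let ?K = "onorm T'"
    show "\<forall>\<^sub>F z in at x. norm ((S z - S x - ?D (z - x)) /\<^sub>R norm (z - x))
        \<le> 2 * norm (S x) * norm (?r z) * norm (S x) + norm (S z - S x) * ?K * norm (S x)"
      using bound in_D eventually_neq_at_within[of x x UNIV]
    proof eventually_elim
      case (elim z)
      let ?n = "norm (z - x)"
      have n: "?n > 0"
        using elim(3) by simp
      have "S z - S x - ?D (z - x)
          = (S z o\<^sub>L (T x - T z) o\<^sub>L S x) + (S x o\<^sub>L T' (z - x) o\<^sub>L S x)"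
        using resolvent[OF elim(2)] by simp
      \<comment> \<open>The error splits into the remainder of \<open>T\<close>, small by
        differentiability, and a term with the factor \<open>S z - S x\<close>, small by
        continuity.\<close>
      also have "\<dots> = - (S z o\<^sub>L (T z - T x - T' (z - x)) o\<^sub>L S x)
          - ((S z - S x) o\<^sub>L T' (z - x) o\<^sub>L S x)"
        by (simp add: blinfun_compose_simps)
      finally have eq: "S z - S x - ?D (z - x) = \<dots>" .
      have "(S z - S x - ?D (z - x)) /\<^sub>R ?n
          = - (S z o\<^sub>L ?r z o\<^sub>L S x) - ((S z - S x) o\<^sub>L T' (z - x) /\<^sub>R ?n o\<^sub>L S x)"
        unfolding eq by (simp add: blinfun_compose_simps scaleR_diff_right scaleR_add_right)
      then have "norm ((S z - S x - ?D (z - x)) /\<^sub>R ?n)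
          \<le> norm (S z o\<^sub>L ?r z o\<^sub>L S x) + norm ((S z - S x) o\<^sub>L T' (z - x) /\<^sub>R ?n o\<^sub>L S x)"
        by (metis norm_minus_cancel norm_triangle_ineq4)
      also have "\<dots> \<le> norm (S z) * norm (?r z) * norm (S x)
          + norm (S z - S x) * norm (T' (z - x) /\<^sub>R ?n) * norm (S x)"
        by (intro add_mono norm3)
      also have "\<dots> \<le> 2 * norm (S x) * norm (?r z) * norm (S x) + norm (S z - S x) * ?K * norm (S x)"
        using elim(1) onorm[OF T'.bounded_linear, of "z - x"] n
        by (intro add_mono mult_right_mono mult_left_mono) (auto simp: field_simps)
      finally show ?case .
    qed
    have "((\<lambda>z. 2 * norm (S x) * norm (?r z) * norm (S x) + norm (S z - S x) * ?K * norm (S x))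
        \<longlongrightarrow> 2 * norm (S x) * norm (0 :: 'b \<Rightarrow>\<^sub>L 'b) * norm (S x)
          + norm (0 :: 'b \<Rightarrow>\<^sub>L 'b) * ?K * norm (S x)) (at x)"
      using T'(1) unfolding has_derivative_at_within by (intro tendsto_intros S_lim) auto
    then show "((\<lambda>z. 2 * norm (S x) * norm (?r z) * norm (S x) + norm (S z - S x) * ?K * norm (S x))
        \<longlongrightarrow> 0) (at x)"
      by simp
  qed
  ultimately have "(S has_derivative ?D) (at x)"
    by (simp add: has_derivative_at_within)
  moreover have "complex_homogeneous ?D"
    using S[OF x] T'(2)
    by (auto simp: complex_homogeneous_def bounded_ops_def blinfun_apply_scaleC
        blinfun.minus_left scaleC_minus_right intro!: blinfun_eqI)
  ultimately show "\<exists>F. (S has_derivative F) (at x) \<and> complex_homogeneous F"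
    by blast
qed

lemma biholomorphic_on_skew_product:
  fixes f :: "'a::complex_banach \<Rightarrow> 'a" and T :: "'a \<Rightarrow> 'b::complex_banach \<Rightarrow>\<^sub>L 'b"
  assumes f: "biholomorphic_on f D" and D: "open D"
    and T: "holomorphic_map_on T D"
    and lin: "\<And>x. x \<in> D \<Longrightarrow> T x \<in> \<L>" and inv: "\<And>x. x \<in> D \<Longrightarrow> invertible_op (T x)"
    and U: "open U" "U \<subseteq> D \<times> UNIV"
    and F: "\<And>x y. (x, y) \<in> U \<Longrightarrow> F (x, y) = (f x, T x y)"
  shows "biholomorphic_on F U"
proof -
  define k where "k = inv_into D f"
  have inj: "inj_on f D" and open_f: "open (f ` D)" and hol_f: "holomorphic_map_on f D"
    and hol_k: "holomorphic_map_on k (f ` D)"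
    using f by (auto simp: biholomorphic_on_def k_def)
  have k: "k (f x) = x" if "x \<in> D" for x
    using that inj by (simp add: k_def)
  have kD: "k ` f ` D \<subseteq> D"
    using k by auto
  obtain S where S: "\<And>x. x \<in> D \<Longrightarrow> S x \<in> \<L>" "\<And>x. x \<in> D \<Longrightarrow> S x o\<^sub>L T x = id_blinfun"
    "\<And>x. x \<in> D \<Longrightarrow> T x o\<^sub>L S x = id_blinfun"
    using inv unfolding invertible_op_def by metis
  have ST: "S x (T x y) = y" "T x (S x y) = y" if "x \<in> D" for x y
    using S(2,3)[OF that] by (metis blinfun_apply_blinfun_compose blinfun_apply_id_blinfun)+
  define g where "g = (\<lambda>w. (k (fst w), S (k (fst w)) (snd w)))"
  have "holomorphic_map_on S D"
    by (rule holomorphic_map_on_inverse[OF T D S])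
  then have "holomorphic_map_on (\<lambda>w. S (k w)) (f ` D)"
    by (rule holomorphic_map_on_compose[OF hol_k _ kD])
  then have hol_g: "holomorphic_map_on g (f ` D \<times> UNIV)"
    unfolding g_def using S(1) kD
    by (intro holomorphic_map_on_skew_product hol_k) auto
  have gF: "g (F z) = z" if "z \<in> U" for z
  proof -
    obtain x y where z: "z = (x, y)"
      by force
    then have "x \<in> D" "F z = (f x, T x y)"
      using that U(2) F by auto
    then show ?thesis
      by (simp add: z g_def k ST)
  qed
  \<comment> \<open>Writing the image as a preimage under the continuous map \<open>g\<close> is
    what shows that it is open.\<close>
  have image: "F ` U = (f ` D \<times> UNIV) \<inter> g -` U"
  proof (intro equalityI subsetI)
    fix w
    assume "w \<in> F ` U"
    then obtain x y where xy: "(x, y) \<in> U" "w = F (x, y)"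
      by force
    moreover from this have "w \<in> f ` D \<times> UNIV"
      using U(2) by (auto simp: F)
    ultimately show "w \<in> (f ` D \<times> UNIV) \<inter> g -` U"
      by (simp add: gF)
  next
    fix w
    assume w: "w \<in> (f ` D \<times> UNIV) \<inter> g -` U"
    then obtain x v where x: "x \<in> D" "w = (f x, v)"
      by force
    then have "g w = (x, S x v)"
      by (simp add: g_def k)
    moreover from this w have "F (x, S x v) = w"
      using x by (simp add: F ST)
    ultimately have "F (g w) = w"
      by simp
    with w show "w \<in> F ` U"
      by (metis IntD2 image_eqI vimageD)
  qed
  have open_image: "open (F ` U)"
    unfolding image
    by (intro continuous_open_preimage holomorphic_map_on_imp_continuous_on[OF hol_g] open_Times
        open_f open_UNIV U(1))
  have "inj_on F U"
    using gF by (rule inj_on_inverseI)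
  moreover have "holomorphic_map_on F U"
    by (rule holomorphic_map_on_cong[OF U(1) _ holomorphic_map_on_subset
          [OF holomorphic_map_on_skew_product[OF hol_f T lin] U(2)]])
       (auto simp: F)
  moreover have "holomorphic_map_on (inv_into U F) (F ` U)"
  proof (rule holomorphic_map_on_cong[OF open_image _ holomorphic_map_on_subset[OF hol_g]])
    show "inv_into U F w = g w" if "w \<in> F ` U" for w
      using that \<open>inj_on F U\<close> gF by auto
  qed (simp add: image)
  ultimately show ?thesis
    using open_image by (simp add: biholomorphic_on_def)
qed

section \<open>The extended domain and block operators\<close>

lemma profile_pos:
  assumes "profile p" "0 \<le> s" "s < 1"
  shows "p s > 0"
proof -
  have "monotone_on {0..1} (<) (>) p"
    using assms(1) unfolding profile_def by blast
  from monotone_onD[OF this, of s 1] assms show ?thesis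
    by (simp add: profile_def)
qed

lemma profile_le_1:
  assumes "profile p" "0 \<le> s" "s \<le> 1"
  shows "p s \<le> 1"
proof -
  have "p ` {0..1} \<subseteq> {0..1}"
    using assms(1) unfolding profile_def by blast
  with assms(2,3) show ?thesis
    by (auto dest!: subsetD[OF _ imageI, of p "{0..1}" _ s])
qed

text \<open>The domain is the set in \<open>ball 0 1 \<times> UNIV\<close> where a continuous
  function is positive; the bound \<open>norm y < 1\<close> is implied because \<open>p\<close> is
  at most 1.\<close>

lemma open_ext_ball:
  assumes "profile p"
  shows "open (ext_ball p :: ('a::complex_banach \<times> 'b::complex_banach) set)"
proof -
  let ?D = "ball 0 1 \<times> UNIV :: ('a \<times> 'b) set"
  let ?f = "\<lambda>z :: 'a \<times> 'b. p (norm (fst z)) - norm (snd z)"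
  have "continuous_on {0..1} p"
    using assms unfolding profile_def by blast
  then have "continuous_on ?D (\<lambda>z. p (norm (fst z)))"
    by (rule continuous_on_compose2) (intro continuous_intros, auto)
  then have "open (?D \<inter> ?f -` {0<..})"
    by (intro continuous_open_preimage continuous_intros open_Times) auto
  also have "?D \<inter> ?f -` {0<..} = ext_ball p"
  proof (intro equalityI subsetI)
    fix z :: "'a \<times> 'b"
    assume "z \<in> ?D \<inter> ?f -` {0<..}"
    with profile_le_1[OF assms, of "norm (fst z)"] show "z \<in> ext_ball p"
      by (auto simp: ext_ball_def)
  qed (auto simp: ext_ball_def)
  finally show ?thesis .
qed

section \<open>Block-diagonal operators and their spectra\<close>

lemma block_op_in_bounded_ops: "S \<in> \<L> \<Longrightarrow> T \<in> \<L> \<Longrightarrow> block_op S T \<in> \<L>"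
  by (simp add: bounded_ops_def complex_homogeneous_def scaleC_prod_def)

lemma block_op_eqI:
  assumes "\<And>x y. blinfun_apply P (x, y) = (blinfun_apply S x, blinfun_apply T y)"
  shows "P = block_op S T"
proof (rule blinfun_eqI)
  show "P z = block_op S T z" for z
    by (cases z) (simp only: assms block_op_apply)
qed

lemma invertible_block_op:
  assumes "invertible_op S" "invertible_op T"
  shows "invertible_op (block_op S T)"
proof -
  obtain S' T' where inv: "S' \<in> \<L>" "T' \<in> \<L>" "S' o\<^sub>L S = id_blinfun" "S o\<^sub>L S' = id_blinfun"
    "T' o\<^sub>L T = id_blinfun" "T o\<^sub>L T' = id_blinfun"
    using assms unfolding invertible_op_def by blast
  have id: "block_op id_blinfun id_blinfun = (id_blinfun :: ('a \<times> 'b) \<Rightarrow>\<^sub>L ('a \<times> 'b))"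
    by (rule block_op_eqI[symmetric]) simp
  have "block_op P Q o\<^sub>L block_op P' Q' = block_op (P o\<^sub>L P') (Q o\<^sub>L Q')"
    for P P' :: "'a \<Rightarrow>\<^sub>L 'a" and Q Q' :: "'b \<Rightarrow>\<^sub>L 'b"
    by (rule block_op_eqI) simp
  then show ?thesis
    unfolding invertible_op_def using inv
    by (intro bexI[of _ "block_op S' T'"]) (simp_all add: id block_op_in_bounded_ops)
qed

lemma op_spectrum_block_op_subset: "op_spectrum (block_op S T) \<subseteq> op_spectrum S \<union> op_spectrum T"
proof -
  have "block_op S T - z *\<^sub>C id_blinfun = block_op (S - z *\<^sub>C id_blinfun) (T - z *\<^sub>C id_blinfun)"
    for z
    by (rule block_op_eqI)
       (simp add: blinfun.diff_left blinfun_apply_scaleC scaleC_prod_def)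
  then show ?thesis
    using invertible_block_op by (fastforce simp: op_spectrum_def)
qed

lemma Re_spectrum_bounded_away_block_op:
  assumes "Re_spectrum_bounded_away S" "Re_spectrum_bounded_away T"
  shows "Re_spectrum_bounded_away (block_op S T)"
proof -
  obtain \<delta> \<epsilon> where "\<delta> > 0" "\<forall>z\<in>op_spectrum S. \<delta> \<le> \<bar>Re z\<bar>" "\<epsilon> > 0" "\<forall>z\<in>op_spectrum T. \<epsilon> \<le> \<bar>Re z\<bar>"
    using assms unfolding Re_spectrum_bounded_away_def by blast
  then have "min \<delta> \<epsilon> > 0" "\<forall>z\<in>op_spectrum (block_op S T). min \<delta> \<epsilon> \<le> \<bar>Re z\<bar>"
    using op_spectrum_block_op_subset[of S T] by fastforce+
  then show ?thesis
    unfolding Re_spectrum_bounded_away_def by blast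
qed

lemma ext_ball_iff:
  assumes "profile p"
  shows "(x, y) \<in> ext_ball p \<longleftrightarrow> norm x < 1 \<and> norm y < p (norm x)"
  using profile_le_1[OF assms, of "norm x"] by (auto simp: ext_ball_def)

text \<open>The bound on \<open>Gh\<close> is the ratio of the radii allowed for the second
  coordinate over \<open>g x\<close> and over \<open>x\<close>. Both radii are positive, so the
  strict inequality survives.\<close>

lemma appropriate_hat_preserves_ext_ball:
  assumes p: "profile p" and hat: "appropriate_hat p Kh Gh" and g: "g \<in> Kh"
    and xy: "(x, y) \<in> ext_ball p"
  shows "(g x, Gh g x y) \<in> ext_ball p"
proof -
  have x: "x \<in> ball 0 1" and y: "norm y < p (norm x)"
    using xy by (auto simp: ext_ball_iff[OF p])
  have "\<forall>f\<in>Kh. \<forall>x\<in>ball 0 1. norm (Gh f x) \<le> p (norm (f x)) / p (norm x)"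
    using hat unfolding appropriate_hat_def by (elim conjE)
  then have Gh: "norm (Gh g x) \<le> p (norm (g x)) / p (norm x)"
    using g x by blast
  have "Kh \<subseteq> Hol (ball 0 1) (ball 0 1)"
    using hat unfolding appropriate_hat_def by (elim conjE)
  then have "g \<in> ball 0 1 \<rightarrow>\<^sub>E ball 0 1"
    using g by (auto simp: Hol_def)
  then have "g x \<in> ball 0 1"
    using x by (rule PiE_mem)
  then have gx: "norm (g x) < 1"
    by simp
  have pos: "p (norm x) > 0" "p (norm (g x)) > 0"
    using profile_pos[OF p] x gx by auto
  have "norm (Gh g x y) \<le> p (norm (g x)) / p (norm x) * norm y"
    using norm_blinfun mult_right_mono[OF Gh norm_ge_zero] by (rule order_trans)
  also have "\<dots> < p (norm (g x))"
    using y pos by (simp add: field_simps)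
  finally show ?thesis
    using gx by (simp add: ext_ball_iff[OF p])
qed

theorem theorem5p1:
  fixes p :: "real \<Rightarrow> real"
    and Kh K :: "('x::complex_banach \<Rightarrow> 'x) set"
    and Gh G :: "('x \<Rightarrow> 'x) \<Rightarrow> 'x \<Rightarrow> ('y::complex_banach \<Rightarrow>\<^sub>L 'y)"
    and h :: "'x \<Rightarrow> 'x"
    and A :: "'x \<Rightarrow>\<^sub>L 'x"
    and B C :: "'y \<Rightarrow>\<^sub>L 'y"
  assumes "profile p"
    and "appropriate_hat p Kh Gh"
    and "appropriate Kh Gh K G"
    and "h \<in> Hol (ball 0 1) UNIV"
    and "spirallike_on A h (ball 0 1)"
    and "\<forall>t\<ge>0. compose (ball 0 1) (blinfun_apply (op_exp (- (t *\<^sub>R A)))) h \<in> K"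
    and "C \<in> \<L>"
    and "\<forall>t\<ge>0. \<forall>x\<in>ball 0 1.
           G (compose (ball 0 1) (blinfun_apply (op_exp (- (t *\<^sub>R A)))) h) x
             = op_exp (- (t *\<^sub>R C)) o\<^sub>L G h x"
    and "B \<in> \<L>"
    and "accretive B"
    and "B o\<^sub>L C = C o\<^sub>L B"
    and "\<forall>x\<in>ball 0 1. B o\<^sub>L G h x = G h x o\<^sub>L B"
    and "Re_spectrum_bounded_away (B + C)"
  shows "spirallike_on (block_op A (B + C)) (ext_op p G h) (ext_ball p)"
proof -
  let ?D = "ball 0 1 :: 'x set"
  let ?U = "ext_ball p :: ('x \<times> 'y) set"
  let ?F = "ext_op p G h"
  have A: "A \<in> \<L>" and bih: "biholomorphic_on h ?D" and ReA: "Re_spectrum_bounded_away A"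
    and invariant: "\<And>w t. w \<in> h ` ?D \<Longrightarrow> t \<ge> 0 \<Longrightarrow> op_exp (- (t *\<^sub>R A)) w \<in> h ` ?D"
    using assms(5) by (auto simp: spirallike_on_def)
  have ext: "h \<in> extensional ?D" and inj: "inj_on h ?D"
    using assms(4) bih by (auto simp: Hol_def PiE_def biholomorphic_on_def)
  \<comment> \<open>Time 0 of the orbit puts \<open>h\<close> itself into \<open>K\<close>.\<close>
  have "compose ?D (blinfun_apply (op_exp (- (0 *\<^sub>R A)))) h = h"
    using ext by (intro extensionalityI[of _ ?D]) (auto simp: compose_def)
  with assms(6) have hK: "h \<in> K"
    by (metis order_refl)
  have "\<forall>h\<in>K. \<forall>x\<in>?D. G h x \<in> \<L>" "\<forall>h\<in>K. \<forall>x\<in>?D. invertible_op (G h x)"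
    "\<forall>h\<in>K. holomorphic_map_on (G h) ?D"
    and transition: "\<forall>h1\<in>K. \<forall>h2\<in>K. h1 ` ?D \<subseteq> h2 ` ?D \<longrightarrow> compose ?D (inv_into ?D h2) h1 \<in> Kh"
    and chain: "\<forall>h\<in>K. \<forall>g\<in>Kh. compose ?D h g \<in> K \<longrightarrow>
      (\<forall>x\<in>?D. G h (g x) o\<^sub>L Gh g x = G (compose ?D h g) x)"
    using assms(3) unfolding appropriate_def by - (elim conjE, assumption)+
  with hK have lin: "\<And>x. x \<in> ?D \<Longrightarrow> G h x \<in> \<L>" and inv: "\<And>x. x \<in> ?D \<Longrightarrow> invertible_op (G h x)"
    and holG: "holomorphic_map_on (G h) ?D"
    by blast+

  \<comment> \<open>Biholomorphy of the extended mapping\<close>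
  have F: "?F (x, y) = (h x, G h x y)" if "(x, y) \<in> ?U" for x y
    using that by (simp add: ext_op_def)
  have "?U \<subseteq> ?D \<times> UNIV"
    by (auto simp: ext_ball_def)
  then have biholomorphic: "biholomorphic_on ?F ?U"
    by (intro biholomorphic_on_skew_product[OF bih open_ball holG lin inv open_ext_ball[OF assms(1)] _ F])

  \<comment> \<open>Invariance of the image under the block flow\<close>
  have invariant_F: "op_exp (- (t *\<^sub>R block_op A (B + C))) w \<in> ?F ` ?U"
    if w: "w \<in> ?F ` ?U" and t: "t \<ge> 0" for w t
  proof -
    obtain x y where xy: "(x, y) \<in> ?U" and w_eq: "w = (h x, G h x y)"
      using w F by auto
    have x: "x \<in> ?D"
      using xy by (auto simp: ext_ball_def)
    define ht where "ht = compose ?D (blinfun_apply (op_exp (- (t *\<^sub>R A)))) h"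
    define g where "g = compose ?D (inv_into ?D h) ht"
    let ?EB = "op_exp (- (t *\<^sub>R B))"
    let ?EC = "op_exp (- (t *\<^sub>R C))"
    have htK: "ht \<in> K" and Ght: "G ht x = ?EC o\<^sub>L G h x"
      using assms(6,8) t x by (auto simp: ht_def)
    \<comment> \<open>Spirallikeness of \<open>h\<close> gives exactly the inclusion under which the
      transition map \<open>g\<close> belongs to \<open>Kh\<close>.\<close>
    have sub: "ht ` ?D \<subseteq> h ` ?D"
      using invariant t by (auto simp: ht_def compose_def)
    then have g: "g \<in> Kh"
      unfolding g_def using transition htK hK by blast
    \<comment> \<open>This identity also places the composition in \<open>K\<close>, as the chain
      rule requires.\<close>
    have hg: "compose ?D h g = ht"
    proof (rule extensionalityI[of _ ?D])
      show "compose ?D h g z = ht z" if "z \<in> ?D" for z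
        using sub that by (auto simp: compose_def g_def f_inv_into_f image_subset_iff)
    qed (simp_all add: ht_def)
    have "compose ?D h g \<in> K"
      by (simp add: hg htK)
    then have "G h (g x) o\<^sub>L Gh g x = G (compose ?D h g) x"
      using chain hK g x by blast
    then have GGh: "G h (g x) o\<^sub>L Gh g x = ?EC o\<^sub>L G h x"
      unfolding hg Ght .
    have gU: "(g x, Gh g x y) \<in> ?U"
      by (rule appropriate_hat_preserves_ext_ball[OF assms(1,2) g xy])
    then have gx: "g x \<in> ?D"
      by (auto simp: ext_ball_def)
    \<comment> \<open>The second coordinate of the preimage: \<open>Gh\<close> accounts for the flow
      of \<open>C\<close>, and the contraction \<open>?EB\<close> for that of
      \<open>B\<close>.\<close>
    define y' where "y' = ?EB (Gh g x y)"
    have "norm y' \<le> norm (Gh g x y)"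
      unfolding y'_def by (rule op_exp_accretive_contraction[OF assms(10) t])
    with gU have y'U: "(g x, y') \<in> ?U"
      by (auto simp: ext_ball_iff[OF assms(1)])
    \<comment> \<open>Commutation is used at the moved point \<open>g x\<close>, since
      \<open>?EB\<close> has to pass through \<open>G h (g x)\<close> to act on the
      argument.\<close>
    have "G h (g x) o\<^sub>L (- (t *\<^sub>R B)) = (- (t *\<^sub>R B)) o\<^sub>L G h (g x)"
      using assms(12) gx by (simp add: blinfun_compose_simps)
    then have comm: "G h (g x) o\<^sub>L ?EB = ?EB o\<^sub>L G h (g x)"
      by (rule op_exp_commute)
    have "(- (t *\<^sub>R B)) o\<^sub>L (- (t *\<^sub>R C)) = (- (t *\<^sub>R C)) o\<^sub>L (- (t *\<^sub>R B))"
      using assms(11) by (simp add: blinfun_compose_simps)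
    from op_exp_add_commuting[OF this]
    have exp_add: "op_exp (- (t *\<^sub>R (B + C))) = ?EB o\<^sub>L ?EC"
      by (simp add: scaleR_add_right)
    have "op_exp (- (t *\<^sub>R (B + C))) (G h x y) = ?EB ((?EC o\<^sub>L G h x) y)"
      by (simp add: exp_add)
    also have "\<dots> = (?EB o\<^sub>L G h (g x)) (Gh g x y)"
      by (simp flip: GGh)
    also have "\<dots> = G h (g x) y'"
      by (simp add: y'_def flip: comm)
    finally have snd: "op_exp (- (t *\<^sub>R (B + C))) (G h x y) = G h (g x) y'" .
    have fst: "op_exp (- (t *\<^sub>R A)) (h x) = h (g x)"
      using fun_cong[OF hg, of x] x by (simp add: ht_def compose_def)
    have "- (t *\<^sub>R block_op A (B + C)) = block_op (- (t *\<^sub>R A)) (- (t *\<^sub>R (B + C)))"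
      by (rule block_op_eqI) (simp add: blinfun.minus_left blinfun.scaleR_left)
    then have "op_exp (- (t *\<^sub>R block_op A (B + C))) w = ?F (g x, y')"
      by (simp add: op_exp_block_op w_eq fst snd F[OF y'U])
    with y'U show ?thesis
      by blast
  qed
  have "B + C \<in> \<L>"
    using assms(7,9)
    by (simp add: bounded_ops_def complex_homogeneous_def blinfun.add_left scaleC_add_right)
  then show ?thesis
    unfolding spirallike_on_def
    by (intro conjI ballI allI impI block_op_in_bounded_ops[OF A] biholomorphic invariant_F
        Re_spectrum_bounded_away_block_op[OF ReA assms(13)])
qed

end
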